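(* Let $R(z,t)$ be a smooth one-parameter family of rational functions of $z$ with critical points $a_l=a_l(t)$ ($1\le l\le M$) and poles $b_j=b_j(t)$ ($1\le j\le N$), of fixed multiplicities and normalized as described in the context. Let $A_l(t)=R(a_l(t),t)$ be the critical values. Then the family satisfies the differential equation $$\frac{\dot R(z,t)}{R'(z,t)}=\sum_{l=1}^{M}\frac{P_{l,m_l-2}(z,t)}{(z-a_l)^{m_l-1}}\,\dot A_l ,$$ where $P_{l,m_l-2}(\cdot,t)$ is the Taylor polynomial of degree $m_l-2$ at the point $a_l$ of the function $$H_l(z,t)=\frac{\prod_{j=1}^N (z-b_j)^{n_j+1}}{\prod_{k=1,\,k\ne l}^M (z-a_k)^{m_k-1}},\qquad\text{i.e.}\qquad P_{l,m_l-2}(z,t)=\sum_{s=0}^{m_l-2}\frac{1}{s!}\,H_l^{(s)}(a_l,t)\,(z-a_l)^s ,$$ the derivatives $H_l^{(s)}$ being taken with respect to $z$.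
   Context: A dot denotes $\partial/\partial t$ (with $z$ fixed) or $d/dt$; a prime denotes $\partial/\partial z$. The parameter $t$ ranges over a real interval. Setting. Integers $m_l\ge 2$ ($1\le l\le M$) and $n_j\ge 1$ ($1\le j\le N$) are fixed, $m=\sum_{l=1}^M (m_l-1)$, $n=\sum_{j=1}^N(n_j+1)$. The points $a_1(t),\dots,a_M(t),b_1(t),\dots,b_N(t)\in\mathbb{C}$ are pairwise distinct for each $t$ and depend smoothly on $t$. For each $t$, $R(\cdot,t)$ is a (single-valued) rational function whose critical points in $\mathbb{C}$ are exactly the $a_l$, of order $m_l-1$, and whose poles in $\mathbb{C}$ are exactly the $b_j$, of order $n_j$, with $$R'(z,t)=\frac{\prod_{l=1}^M (z-a_l)^{m_l-1}}{\prod_{j=1}^N (z-b_j)^{n_j+1}} .$$ Since $R(\cdot,t)$ is single-valued, $m\ne n-1$. The additive constant is fixed as follows: - if $m>n$: $R(z,t)=\int_{a_1}^z \frac{\prod_l(\zeta-a_l)^{m_l-1}}{\prod_j(\zeta-b_j)^{n_j+1}}\,d\zeta$ (so $A_1\equiv 0$); - if $m<n-1$: $R(z,t)=\int_{\infty}^z \frac{\prod_l(\zeta-a_l)^{m_l-1}}{\prod_j(\zeta-b_j)^{n_j+1}}\,d\zeta$; - if $m=n$: $R(z,t)=z+\int_{\infty}^z \Bigl[\frac{\prod_l(\zeta-a_l)^{m_l-1}}{\prod_j(\zeta-b_j)^{n_j+1}}-1\Bigr]d\zeta$. The family is moreover normalized by $\sum_{k=1}^M (m_k-1)a_k-\sum_{j=1}^N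 (n_j+1)b_j=0$ for all $t$. *)

theory Defs
  imports "HOL-Complex_Analysis.Complex_Analysis"
begin

(* C-infinity on T; derivatives are one-sided at end points of T belonging to T. *)
definition smooth_fun_on :: "real set \<Rightarrow> (real \<Rightarrow> complex) \<Rightarrow> bool" where
  "smooth_fun_on T f \<longleftrightarrow>
    (\<exists>D :: nat \<Rightarrow> real \<Rightarrow> complex.
      (\<forall>t\<in>T. D 0 t = f t) \<and>
      (\<forall>k. \<forall>t\<in>T. (D k has_vector_derivative D (Suc k) t) (at t within T)))"

(* A rational function is represented by a total function whose values on its
   finite pole set B are irrelevant. *)
definition rational_fun_off :: "complex set \<Rightarrow> (complex \<Rightarrow> complex) \<Rightarrow> bool" where
  "rational_fun_off B F \<longleftrightarrow>
    (\<exists>p q. \<forall>z. z \<notin> B \<longrightarrow> poly q z \<noteq> 0 \<and> F z = poly p z / poly q z)"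

definition ratio_prod ::
    "nat \<Rightarrow> nat \<Rightarrow> (nat \<Rightarrow> nat) \<Rightarrow> (nat \<Rightarrow> nat) \<Rightarrow> (nat \<Rightarrow> complex) \<Rightarrow> (nat \<Rightarrow> complex) \<Rightarrow> complex \<Rightarrow> complex"
  where
  "ratio_prod M N m n a b z =
    (\<Prod>l=1..M. (z - a l) ^ (m l - 1)) / (\<Prod>j=1..N. (z - b j) ^ (n j + 1))"

(* I is the integral of f from w to z, independently of the path in S. *)
definition integral_between ::
    "complex set \<Rightarrow> (complex \<Rightarrow> complex) \<Rightarrow> complex \<Rightarrow> complex \<Rightarrow> complex \<Rightarrow> bool" where
  "integral_between S f w z I \<longleftrightarrow>
    (\<forall>\<gamma>. valid_path \<gamma> \<and> path_image \<gamma> \<subseteq> S \<and> pathstart \<gamma> = w \<and> pathfinish \<gamma> = z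
       \<longrightarrow> (f has_contour_integral I) \<gamma>)"

(* The integral from infinity to z is the limit of the integrals from w to z as w tends
   to infinity. *)
definition integral_from_infinity ::
    "complex set \<Rightarrow> (complex \<Rightarrow> complex) \<Rightarrow> complex \<Rightarrow> complex \<Rightarrow> bool" where
  "integral_from_infinity S f z I \<longleftrightarrow>
    (\<exists>J. (\<forall>w\<in>S. integral_between S f w z (J w)) \<and> (J \<longlongrightarrow> I) at_infinity)"

definition total_crit :: "nat \<Rightarrow> (nat \<Rightarrow> nat) \<Rightarrow> nat" where
  "total_crit M m = (\<Sum>l=1..M. m l - 1)"

definition total_pole :: "nat \<Rightarrow> (nat \<Rightarrow> nat) \<Rightarrow> nat" where
  "total_pole N n = (\<Sum>j=1..N. n j + 1)"

(* The choice of the additive constant. The remaining case, where total_crit + 1 = total_pole,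
   is excluded by single-valuedness: there the derivative behaves like 1/z at infinity. *)
definition additive_normalized ::
    "nat \<Rightarrow> nat \<Rightarrow> (nat \<Rightarrow> nat) \<Rightarrow> (nat \<Rightarrow> nat) \<Rightarrow> (nat \<Rightarrow> complex) \<Rightarrow> (nat \<Rightarrow> complex)
      \<Rightarrow> (complex \<Rightarrow> complex) \<Rightarrow> bool" where
  "additive_normalized M N m n a b F \<longleftrightarrow>
    (let f = ratio_prod M N m n a b; S = - (b ` {1..N}) in
      (total_crit M m > total_pole N n \<longrightarrow>
         (\<forall>z\<in>S. integral_between S f (a 1) z (F z))) \<and>
      (total_crit M m + 1 < total_pole N n \<longrightarrow>
         (\<forall>z\<in>S. integral_from_infinity S f z (F z))) \<and>
      (total_crit M m = total_pole N n \<longrightarrow>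
         (\<forall>z\<in>S. integral_from_infinity S (\<lambda>\<zeta>. f \<zeta> - 1) z (F z - z))))"

definition rational_with_data ::
    "nat \<Rightarrow> nat \<Rightarrow> (nat \<Rightarrow> nat) \<Rightarrow> (nat \<Rightarrow> nat) \<Rightarrow> (nat \<Rightarrow> complex) \<Rightarrow> (nat \<Rightarrow> complex)
      \<Rightarrow> (complex \<Rightarrow> complex) \<Rightarrow> bool" where
  "rational_with_data M N m n a b F \<longleftrightarrow>
    rational_fun_off (b ` {1..N}) F \<and>
    {z. z \<notin> b ` {1..N} \<and> deriv F z = 0} = a ` {1..M} \<and>
    (\<forall>l\<in>{1..M}. zorder (deriv F) (a l) = int (m l - 1)) \<and>
    {z. is_pole F z} = b ` {1..N} \<and>
    (\<forall>j\<in>{1..N}. zorder F (b j) = - int (n j)) \<and>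
    (\<forall>z. z \<notin> b ` {1..N} \<longrightarrow> (F has_field_derivative ratio_prod M N m n a b z) (at z))"

definition H_fun ::
    "nat \<Rightarrow> nat \<Rightarrow> (nat \<Rightarrow> nat) \<Rightarrow> (nat \<Rightarrow> nat) \<Rightarrow> (nat \<Rightarrow> complex) \<Rightarrow> (nat \<Rightarrow> complex)
      \<Rightarrow> nat \<Rightarrow> complex \<Rightarrow> complex" where
  "H_fun M N m n a b l z =
    (\<Prod>j=1..N. (z - b j) ^ (n j + 1)) / (\<Prod>k\<in>{1..M} - {l}. (z - a k) ^ (m k - 1))"

definition taylor_poly :: "(complex \<Rightarrow> complex) \<Rightarrow> complex \<Rightarrow> nat \<Rightarrow> complex \<Rightarrow> complex" where
  "taylor_poly h c d z = (\<Sum>s=0..d. (deriv ^^ s) h c / fact s * (z - c) ^ s)"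

end

theory Submission
  imports Defs
begin

text \<open>
Fix \<open>t\<close> and write \<open>f(z,s) = R'(z,s)\<close>, a dot for the derivative in \<open>s\<close> at \<open>s = t\<close>, and \<open>G\<close> for the
function \<open>R\<close>-dot of \<open>z\<close>.  The identity is the partial fraction expansion of
\<open>G/f\<close>: this quotient has poles only at the critical points \<open>a\<^sub>l\<close>, it vanishes at infinity,
and its principal part at \<open>a\<^sub>l\<close> is the \<open>l\<close>-th summand.  The difference of the two sides is holomorphic
off finitely many points; all of these turn out to be removable and the difference tends to 0 at
infinity, so that it vanishes by Liouville's theorem
(\<open>Liouville_finite_singularities\<close>, \<open>quotient_eq_principal_parts\<close>).

The local information comes from \<open>G' = f L\<close>, where
\<open>L = \<Sum>\<^sub>j (n\<^sub>j + 1) b\<^sub>j'/(z - b\<^sub>j) - \<Sum>\<^sub>l (m\<^sub>l - 1) a\<^sub>l'/(z - a\<^sub>l)\<close> is the logarithmic derivative of \<open>f\<close> in \<open>s\<close>,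
by integrating the order of growth of \<open>G'\<close>:

\<^item> at \<open>b\<^sub>j\<close> the function \<open>G'\<close> has order at least \<open>-(n\<^sub>j + 2)\<close>, so \<open>G\<close> is at most as singular as \<open>f\<close>;

\<^item> at \<open>a\<^sub>l\<close> it has order at least \<open>m\<^sub>l - 2\<close>, so \<open>G - G(a\<^sub>l)\<close> has order at least \<open>m\<^sub>l - 1\<close>, and
  \<open>G/f\<close> differs from \<open>G(a\<^sub>l)/f\<close> by a bounded function; here \<open>1/f = H\<^sub>l/(z - a\<^sub>l)^(m\<^sub>l - 1)\<close>, and the
  Taylor polynomial of \<open>H\<^sub>l\<close> yields the principal part;

\<^item> at infinity the centering condition, differentiated in \<open>s\<close>, gives \<open>L = O(z^(-2))\<close>.  For \<open>m > n\<close> this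
  bounds \<open>G\<close> by \<open>o(f)\<close>.  For \<open>m \<le> n\<close> one needs in addition \<open>G \<rightarrow> 0\<close>, which is what the normalization
  of \<open>R\<close> at infinity provides.

Finally \<open>G\<close> has to exist, and \<open>G(a\<^sub>l)\<close> has to be the derivative of the critical value.  On compact sets
that avoid the poles the difference quotients of \<open>f\<close> in \<open>s\<close> converge uniformly, hence so do the
increments of the difference quotients of \<open>R\<close> from one point to another.  It remains to have convergence
at one point.  If \<open>m > n\<close> this point is \<open>a\<^sub>1\<close>, where \<open>R\<close> vanishes.  Otherwise the normalization at
infinity is equivalent to the vanishing of the mean of \<open>R\<close> over one large circle
(\<open>normalized_circle_mean\<close>, \<open>circle_mean_at_infinity\<close>), a condition that involves a compact set only and
so passes to the limit; it gives both the convergence and \<open>G \<rightarrow> 0\<close> at infinity.  The case \<open>m = n - 1\<close> does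
not occur, since \<open>f\<close> would have a residue at infinity (\<open>single_valued_degrees\<close>).  The critical values
cause no extra term, since \<open>f\<close> is small near \<open>a\<^sub>l\<close> (\<open>critical_value_shift\<close>).
\<close>

section \<open>Liouville's theorem with removable singularities\<close>

text \<open>The singularities are removed one at a time. The limit condition at a remaining point
survives, since the extended function agrees with the given one near that point.\<close>
lemma extend_over_finite_set:
  fixes E :: "complex \<Rightarrow> complex"
  assumes "finite K" "E holomorphic_on (-K)"
    and "\<And>c. c \<in> K \<Longrightarrow> ((\<lambda>z. (z - c) * E z) \<longlongrightarrow> 0) (at c)"
  shows "\<exists>g. g holomorphic_on UNIV \<and> (\<forall>z. z \<notin> K \<longrightarrow> g z = E z)"
  using assms
proof (induction K arbitrary: E rule: finite_induct)
  case empty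
  then show ?case by auto
next
  case (insert c K)
  have op: "open (-K)" and c: "c \<in> interior (-K)"
    using insert.hyps by (auto simp: interior_open finite_imp_closed open_Compl)
  have "- insert c K = - K - {c}" by auto
  then have "E holomorphic_on (-K) - {c}"
    using insert.prems(1) by simp
  from holomorphic_on_extend_lim[OF this c] insert.prems(2)[of c]
  obtain g where g: "g holomorphic_on (-K)" "\<And>z. z \<in> -K - {c} \<Longrightarrow> g z = E z"
    by auto
  have "((\<lambda>z. (z - d) * g z) \<longlongrightarrow> 0) (at d)" if "d \<in> K" for d
  proof -
    have "open (- insert c (K - {d}))"
      using insert.hyps by (intro open_Compl finite_imp_closed) auto
    moreover have "d \<in> - insert c (K - {d})"
      using that insert.hyps by auto
    ultimately have "\<forall>\<^sub>F z in at d. z \<in> - insert c (K - {d})"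
      by (rule eventually_at_in_open')
    moreover have "\<forall>\<^sub>F z in at d. z \<noteq> d"
      by (simp add: eventually_at_filter)
    ultimately have "\<forall>\<^sub>F z in at d. (z - d) * g z = (z - d) * E z"
      by eventually_elim (auto intro!: g)
    from tendsto_cong[OF this] show ?thesis
      using insert.prems(2)[of d] that by simp
  qed
  from insert.IH[OF g(1) this] obtain k where
    "k holomorphic_on UNIV" "\<forall>z. z \<notin> K \<longrightarrow> k z = g z" by blast
  with g(2) show ?case
    by (intro exI[of _ k]) simp
qed

lemma Liouville_finite_singularities:
  fixes E :: "complex \<Rightarrow> complex"
  assumes "finite K" "E holomorphic_on (-K)"
    and "\<And>c. c \<in> K \<Longrightarrow> ((\<lambda>z. (z - c) * E z) \<longlongrightarrow> 0) (at c)"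
    and lim: "(E \<longlongrightarrow> 0) at_infinity" and "z \<notin> K"
  shows "E z = 0"
proof -
  obtain g where g: "g holomorphic_on UNIV" "\<And>z. z \<notin> K \<Longrightarrow> g z = E z"
    using extend_over_finite_set[OF assms(1-3)] by blast
  obtain B where "\<And>z. z \<in> K \<Longrightarrow> norm z < B"
    using finite_imp_bounded[OF \<open>finite K\<close>] unfolding bounded_pos_less by blast
  then have "\<forall>\<^sub>F z in at_infinity. z \<notin> K"
    unfolding eventually_at_infinity by (intro exI[of _ B]) force
  then have "\<forall>\<^sub>F z in at_infinity. E z = g z"
    by eventually_elim (simp add: g)
  then have "(g \<longlongrightarrow> 0) at_infinity"
    using lim by (rule Lim_transform_eventually[rotated])
  then show ?thesis
    using Liouville_weak_0[OF g(1), of z] g(2)[OF \<open>z \<notin> K\<close>] by simp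
qed

section \<open>Growth of a primitive near infinity and near a point\<close>

lemma radial_mean_value:
  fixes g :: "complex \<Rightarrow> complex"
  assumes c: "0 \<le> c" "c \<le> 1"
    and der: "\<And>\<tau>. c \<le> \<tau> \<Longrightarrow> \<tau> \<le> 1 \<Longrightarrow>
      (g has_field_derivative g' (of_real \<tau> * w)) (at (of_real \<tau> * w))"
    and bd: "\<And>\<tau>. c \<le> \<tau> \<Longrightarrow> \<tau> \<le> 1 \<Longrightarrow> norm (g' (of_real \<tau> * w)) \<le> B"
  shows "norm (g w - g (of_real c * w)) \<le> B * norm w"
proof -
  have seg: "\<exists>\<tau>. c \<le> \<tau> \<and> \<tau> \<le> 1 \<and> x = of_real \<tau> * w"
    if "x \<in> closed_segment (of_real c * w) w" for x
  proof -
    obtain u where u: "0 \<le> u" "u \<le> 1" "x = (1 - u) *\<^sub>R (of_real c * w) + u *\<^sub>R w"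
      using \<open>x \<in> _\<close>[unfolded in_segment] by (elim exE conjE)
    have "x = of_real ((1 - u) * c + u) * w"
      unfolding u(3) by (simp add: scaleR_conv_of_real ring_distribs)
    moreover have "c \<le> (1 - u) * c + u"
      using mult_right_mono[of c 1 u] u c unfolding left_diff_distrib by (simp add: mult.commute)
    moreover have "(1 - u) * c + u \<le> 1"
      using mult_left_mono[of c 1 "1 - u"] u c by simp
    ultimately show ?thesis by (intro exI[of _ "(1 - u) * c + u"] conjI)
  qed
  have "norm (g w - g (of_real c * w)) \<le> B * norm (w - of_real c * w)"
  proof (rule field_differentiable_bound[where f=g and f'=g' and x=w and y="of_real c * w"
        and S="closed_segment (of_real c * w) w"])
    fix x assume "x \<in> closed_segment (of_real c * w) w"
    from seg[OF this] obtain \<tau> where \<tau>: "c \<le> \<tau>" "\<tau> \<le> 1" "x = of_real \<tau> * w"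
      by (elim exE conjE)
    show "(g has_field_derivative g' x) (at x within closed_segment (of_real c * w) w)"
      unfolding \<tau>(3) by (rule has_field_derivative_at_within[OF der[OF \<tau>(1,2)]])
    show "norm (g' x) \<le> B"
      unfolding \<tau>(3) by (rule bd[OF \<tau>(1,2)])
  qed simp_all
  also have "norm (w - of_real c * w) = (1 - c) * norm w"
  proof -
    have "w - of_real c * w = of_real (1 - c) * w" by (simp add: algebra_simps)
    moreover have "norm (of_real (1 - c) * w) = (1 - c) * norm w"
      using c by (simp only: norm_mult norm_of_real abs_of_nonneg diff_ge_0_iff_ge)
    ultimately show ?thesis by (simp only:)
  qed
  also have "B * ((1 - c) * norm w) \<le> B * (1 * norm w)"
  proof (intro mult_left_mono mult_right_mono)
    show "0 \<le> B"
      using order_trans[OF norm_ge_zero bd[of 1]] c by simp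
  qed (use c in simp_all)
  finally show ?thesis by simp
qed

text \<open>The bound is only available away from the centre, so the segment from a point close to
the centre is used, and that point is sent to the centre.\<close>
lemma radial_mean_value_limit:
  fixes g :: "complex \<Rightarrow> complex"
  assumes lim: "(g \<longlongrightarrow> l) (at 0)" and "w \<noteq> 0"
    and der: "\<And>\<tau>. 0 < \<tau> \<Longrightarrow> \<tau> \<le> 1 \<Longrightarrow>
      (g has_field_derivative g' (of_real \<tau> * w)) (at (of_real \<tau> * w))"
    and bd: "\<And>\<tau>. 0 < \<tau> \<Longrightarrow> \<tau> \<le> 1 \<Longrightarrow> norm (g' (of_real \<tau> * w)) \<le> B"
  shows "norm (g w - l) \<le> B * norm w"
proof -
  have "((\<lambda>c. g (of_real c * w)) \<longlongrightarrow> l) (at_right 0)"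
    by (rule filterlim_compose[OF lim])
       (auto simp: filterlim_at eventually_at_filter \<open>w \<noteq> 0\<close> intro!: tendsto_eq_intros)
  then have "((\<lambda>c. norm (g w - g (of_real c * w))) \<longlongrightarrow> norm (g w - l)) (at_right 0)"
    by (intro tendsto_intros)
  then show ?thesis
  proof (rule tendsto_upperbound)
    show "\<forall>\<^sub>F c in at_right 0. norm (g w - g (of_real c * w)) \<le> B * norm w"
      using eventually_at_right_real[of 0 "1::real", OF zero_less_one]
      by eventually_elim (intro radial_mean_value[where g'=g'] der bd; simp)
  qed auto
qed

text \<open>The little-o form covers the borderline of a primitive with logarithmic growth, which a
bound by a constant multiple of a power would miss.\<close>
lemma primitive_growth_at_infinity:
  fixes g :: "complex \<Rightarrow> complex"
  assumes der: "\<And>w. norm w \<ge> r \<Longrightarrow> (g has_field_derivative g' w) (at w)"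
    and lim: "((\<lambda>w. g' w / w ^ n) \<longlongrightarrow> 0) at_infinity"
  shows "((\<lambda>w. g w / w ^ Suc n) \<longlongrightarrow> 0) at_infinity"
proof (rule tendstoI)
  fix e :: real assume e: "e > 0"
  from tendstoD[OF lim, of "e/2"] e obtain b where
    b: "\<And>w. norm w \<ge> b \<Longrightarrow> norm (g' w / w ^ n) < e/2"
    by (auto simp: eventually_at_infinity dist_norm)
  define \<rho> where "\<rho> = max (max b r) 1"
  have \<rho>: "\<rho> \<ge> b" "\<rho> \<ge> r" "\<rho> \<ge> 1" by (auto simp: \<rho>_def)
  have "continuous_on (sphere 0 \<rho>) g"
    using \<rho> der by (intro continuous_at_imp_continuous_on ballI DERIV_isCont) auto
  then have "bounded (g ` sphere 0 \<rho>)"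
    by (intro compact_imp_bounded compact_continuous_image) auto
  then obtain C where C: "C > 0" "\<And>w. norm w = \<rho> \<Longrightarrow> norm (g w) \<le> C"
    unfolding bounded_pos by auto
  \<comment> \<open>From here on the contribution \<open>C\<close> of the circle of radius \<open>\<rho>\<close> is below \<open>e/2\<close> times the modulus.\<close>
  define s where "s = max \<rho> (2 * C / e + 1)"
  have "norm (g w / w ^ Suc n) < e" if w: "norm w \<ge> s" for w
  proof -
    have w1: "norm w \<ge> \<rho>" "norm w \<ge> 1" "norm w > 2 * C / e"
      using w \<rho> by (auto simp: s_def)
    have pos: "norm w > 0" using w1 by linarith
    have "norm (g w - g (of_real (\<rho> / norm w) * w)) \<le> (e/2 * norm w ^ n) * norm w"
    proof (rule radial_mean_value[where g'=g'])
      fix \<tau> assume \<tau>: "\<rho> / norm w \<le> \<tau>" "\<tau> \<le> 1"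
      have "\<tau> > 0" using \<tau> \<rho> pos by (intro less_le_trans[OF _ \<tau>(1)] divide_pos_pos) auto
      have n1: "norm (of_real \<tau> * w) = \<tau> * norm w" using \<open>\<tau> > 0\<close> by (simp add: norm_mult)
      have n2: "\<tau> * norm w \<ge> \<rho>" using \<tau> pos by (simp add: field_simps)
      then show "(g has_field_derivative g' (of_real \<tau> * w)) (at (of_real \<tau> * w))"
        using n1 \<rho> by (intro der) auto
      have "norm (g' (of_real \<tau> * w) / (of_real \<tau> * w) ^ n) < e/2"
        using n1 n2 \<rho> by (intro b) auto
      then have "norm (g' (of_real \<tau> * w)) \<le> e/2 * (\<tau> * norm w) ^ n"
        using pos \<open>\<tau> > 0\<close> by (simp add: norm_divide norm_power n1 norm_mult field_simps)
      also have "\<dots> \<le> e/2 * norm w ^ n"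
        using e \<open>\<tau> > 0\<close> \<tau> pos by (intro mult_left_mono power_mono) (auto intro: mult_left_le_one_le)
      finally show "norm (g' (of_real \<tau> * w)) \<le> e/2 * norm w ^ n" .
    qed (use \<rho> w1 pos in auto)
    moreover have "norm (g (of_real (\<rho> / norm w) * w)) \<le> C"
      using pos \<rho> by (intro C) (simp add: norm_mult norm_divide)
    ultimately have "norm (g w) \<le> C + e/2 * norm w ^ Suc n"
      using norm_triangle_sub[of "g w" "g (of_real (\<rho> / norm w) * w)"] by (simp add: mult_ac)
    also have "C < e/2 * norm w"
      using w1 e by (simp add: field_simps)
    also have "e/2 * norm w \<le> e/2 * norm w ^ Suc n"
      using e w1 self_le_power[of "norm w" "Suc n"] by (intro mult_left_mono) auto
    finally show ?thesis
      using pos by (simp add: norm_divide norm_power norm_mult field_simps)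
  qed
  then show "\<forall>\<^sub>F w in at_infinity. dist (g w / w ^ Suc n) 0 < e"
    by (auto simp: eventually_at_infinity)
qed

text \<open>In the coordinate \<open>1/w\<close> the derivative is bounded by a multiple of the
\<open>p\<close>-th power of the modulus and the function vanishes at the origin, so that one
integrates outwards from there.\<close>
lemma primitive_decay_at_infinity:
  fixes g :: "complex \<Rightarrow> complex"
  assumes der: "\<And>w. norm w \<ge> r \<Longrightarrow> (g has_field_derivative g' w) (at w)"
    and bd: "\<And>w. norm w \<ge> r \<Longrightarrow> norm (g' w) * norm w ^ (p + 2) \<le> C"
    and lim: "(g \<longlongrightarrow> 0) at_infinity"
  shows "((\<lambda>w. g w * w ^ p) \<longlongrightarrow> 0) at_infinity"
proof -
  define h where "h = (\<lambda>w. g (inverse w))"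
  define \<rho> where "\<rho> = max r 1"
  have \<rho>: "\<rho> \<ge> r" "\<rho> \<ge> 1" by (auto simp: \<rho>_def)
  have C0: "C \<ge> 0"
  proof (rule order_trans)
    show "0 \<le> norm (g' (of_real \<rho>)) * norm (of_real \<rho> :: complex) ^ (p + 2)" by simp
    show "\<dots> \<le> C" using \<rho> by (intro bd) simp
  qed
  have h0: "(h \<longlongrightarrow> 0) (at 0)"
    unfolding h_def using lim by (simp add: lim_at_infinity_0 o_def)
  have bound: "norm (h w) \<le> C * norm w ^ (p + 1)" if w: "w \<noteq> 0" "norm w \<le> 1/\<rho>" for w
  proof -
    have "norm (h w - 0) \<le> (C * norm w ^ p) * norm w"
    proof (rule radial_mean_value_limit[OF h0 w(1),
          where g'="\<lambda>w. - (g' (inverse w) * inverse w ^ 2)"])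
      fix \<tau> :: real assume \<tau>: "0 < \<tau>" "\<tau> \<le> 1"
      define v where "v = of_real \<tau> * w"
      have nv: "norm v = \<tau> * norm w" using \<tau> by (simp add: v_def norm_mult)
      have v0: "v \<noteq> 0" using w \<tau> by (simp add: v_def)
      have vle: "norm v \<le> norm w" unfolding nv using \<tau> by (intro mult_left_le_one_le) auto
      have "norm v * \<rho> \<le> norm w * \<rho>" using vle \<rho> by (intro mult_right_mono) auto
      also have "\<dots> \<le> 1" using w \<rho> by (simp add: field_simps)
      finally have iv: "norm (inverse v) \<ge> \<rho>"
        using v0 by (simp add: norm_inverse norm_divide field_simps)
      show "(h has_field_derivative - (g' (inverse (of_real \<tau> * w)) * (inverse (of_real \<tau> * w))\<^sup>2))
        (at (of_real \<tau> * w))"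
        unfolding v_def[symmetric] h_def
      proof -
        have "(inverse has_field_derivative - (inverse v ^ 2)) (at v)"
          using DERIV_inverse[OF v0, of UNIV] by (simp add: numeral_2_eq_2)
        from DERIV_chain2[OF der this] iv \<rho>
        show "((\<lambda>w. g (inverse w)) has_field_derivative - (g' (inverse v) * (inverse v)\<^sup>2)) (at v)"
          by simp
      qed
      have "norm (g' (inverse v)) * norm (inverse v) ^ (p + 2) \<le> C"
        using iv \<rho> by (intro bd) auto
      then have "norm (g' (inverse v)) * norm (inverse v) ^ 2 \<le> C * norm v ^ p"
        using v0 by (simp add: norm_inverse norm_divide power_add power2_eq_square field_simps)
      also have "\<dots> \<le> C * norm w ^ p"
        using C0 vle by (intro mult_left_mono power_mono) auto
      finally show "norm (- (g' (inverse (of_real \<tau> * w)) * (inverse (of_real \<tau> * w))\<^sup>2)) \<le> C * norm w ^ p"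
        unfolding v_def[symmetric] by (simp add: norm_mult norm_power)
    qed
    then show ?thesis by (simp add: mult_ac)
  qed
  have "\<forall>\<^sub>F w in at_infinity. norm (g w * w ^ p) \<le> C / norm w"
    unfolding eventually_at_infinity
  proof (intro exI allI impI)
    fix w :: complex assume w: "norm w \<ge> \<rho>"
    then have w0: "w \<noteq> 0" using \<rho> by auto
    have "norm (h (inverse w)) \<le> C * norm (inverse w) ^ (p + 1)"
      using w \<rho> w0 by (intro bound) (auto simp: norm_inverse norm_divide field_simps)
    then show "norm (g w * w ^ p) \<le> C / norm w"
      using w0 by (simp add: h_def norm_mult norm_inverse norm_power norm_divide field_simps)
  qed
  moreover have "((\<lambda>w::complex. C / norm w) \<longlongrightarrow> 0) at_infinity"
    by (intro real_tendsto_divide_at_top[OF tendsto_const] filterlim_norm_at_top)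
  ultimately show ?thesis
    by (rule Lim_null_comparison)
qed

lemma inverse_shift_at_infinity:
  fixes a :: complex
  shows "((\<lambda>z. inverse (z - a)) \<longlongrightarrow> 0) at_infinity"
  using filterlim_compose[OF tendsto_inverse_0 tendsto_add_filterlim_at_infinity'[OF filterlim_ident tendsto_const[of "-a"]]]
  by simp

lemma quotient_shift_at_infinity:
  fixes a :: complex
  shows "((\<lambda>z. z / (z - a)) \<longlongrightarrow> 1) at_infinity"
proof (rule Lim_transform_eventually)
  show "((\<lambda>z. 1 + a * inverse (z - a)) \<longlongrightarrow> 1) at_infinity"
    by (rule tendsto_eq_intros inverse_shift_at_infinity refl | simp)+
  show "\<forall>\<^sub>F z in at_infinity. 1 + a * inverse (z - a) = z / (z - a)"
    using eventually_not_equal_at_infinity[of a]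
    by eventually_elim (simp add: field_simps)
qed

text \<open>The substitution \<open>w = 1/(z - b)\<close> turns this into the statement on growth at
infinity.\<close>
lemma primitive_growth_at_point:
  fixes G :: "complex \<Rightarrow> complex"
  assumes der: "\<forall>\<^sub>F z in at b. (G has_field_derivative g z) (at z)"
    and lim: "((\<lambda>z. g z * (z - b) ^ (p + 2)) \<longlongrightarrow> c) (at b)"
  shows "((\<lambda>z. G z * (z - b) ^ (p + 2)) \<longlongrightarrow> 0) (at b)"
proof -
  define h where "h = (\<lambda>w. G (b + inverse w))"
  define h' where "h' = (\<lambda>w. - (g (b + inverse w) * inverse w ^ 2))"
  from der obtain d where d: "d > 0"
    "\<And>z. z \<noteq> b \<Longrightarrow> dist z b < d \<Longrightarrow> (G has_field_derivative g z) (at z)"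
    by (auto simp: eventually_at)
  have to_b: "filterlim (\<lambda>w. b + inverse w) (at b) at_infinity"
    unfolding filterlim_at
  proof
    show "\<forall>\<^sub>F w in at_infinity. b + inverse w \<in> UNIV \<and> b + inverse w \<noteq> b"
      using eventually_not_equal_at_infinity[of 0] by eventually_elim simp
    show "((\<lambda>w. b + inverse w) \<longlongrightarrow> b) at_infinity"
      using tendsto_add[OF tendsto_const[of b] tendsto_inverse_0] by simp
  qed
  have to_inf: "filterlim (\<lambda>z. inverse (z - b)) at_infinity (at b)"
    by (rule filterlim_compose[OF filterlim_inverse_at_infinity])
       (auto simp: filterlim_at eventually_at_filter intro!: tendsto_eq_intros)
  have "((\<lambda>w. h w / w ^ Suc (p + 1)) \<longlongrightarrow> 0) at_infinity"
  proof (rule primitive_growth_at_infinity)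
    fix w :: complex assume w: "norm w \<ge> 2 / d"
    have w0: "w \<noteq> 0" using w d by auto
    have "norm (inverse w) < d"
    proof -
      have "2 \<le> d * norm w" using w d by (simp add: field_simps)
      then have "1 < d * norm w" by simp
      then show ?thesis using w0 by (simp add: norm_inverse norm_divide field_simps)
    qed
    then have G: "(G has_field_derivative g (b + inverse w)) (at (b + inverse w))"
      using w0 by (intro d) (auto simp: dist_norm)
    have "((\<lambda>w. b + inverse w) has_field_derivative - (inverse w ^ 2)) (at w)"
      using DERIV_inverse[OF w0, of UNIV] by (auto intro!: derivative_eq_intros simp: numeral_2_eq_2 w0)
    from DERIV_chain2[OF G this] show "(h has_field_derivative h' w) (at w)"
      unfolding h_def h'_def by simp
  next
    have 1: "((\<lambda>w. g (b + inverse w) * inverse w ^ (p + 2)) \<longlongrightarrow> c) at_infinity"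
      using filterlim_compose[OF lim to_b] by simp
    have "((\<lambda>w. - (g (b + inverse w) * inverse w ^ (p + 2)) * inverse w) \<longlongrightarrow> - c * 0) at_infinity"
      by (intro tendsto_intros 1 tendsto_inverse_0)
    moreover have "- (g (b + inverse w) * inverse w ^ (p + 2)) * inverse w = h' w / w ^ (p + 1)" for w
      by (simp add: h'_def power2_eq_square divide_inverse power_inverse mult_ac)
    ultimately show "((\<lambda>w. h' w / w ^ (p + 1)) \<longlongrightarrow> 0) at_infinity"
      by simp
  qed
  from filterlim_compose[OF this to_inf]
  have "((\<lambda>z. h (inverse (z - b)) / inverse (z - b) ^ Suc (p + 1)) \<longlongrightarrow> 0) (at b)" .
  moreover have "h (inverse (z - b)) / inverse (z - b) ^ Suc (p + 1) = G z * (z - b) ^ (p + 2)" for z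
    by (simp add: h_def divide_inverse power_inverse)
  ultimately show ?thesis by simp
qed

text \<open>Integration along radii in fact gains one more power of \<open>z - c\<close>; the weaker
conclusion is all that the removability criterion asks for.\<close>
lemma primitive_zero_order:
  fixes G :: "complex \<Rightarrow> complex"
  assumes der: "\<forall>\<^sub>F z in at c. (G has_field_derivative g z) (at z)"
    and lim: "((\<lambda>z. g z / (z - c) ^ p) \<longlongrightarrow> k) (at c)"
    and G: "(G \<longlongrightarrow> l) (at c)"
  shows "((\<lambda>z. (G z - l) / (z - c) ^ p) \<longlongrightarrow> 0) (at c)"
proof -
  define C where "C = norm k + 1"
  have "\<forall>\<^sub>F z in at c. norm (g z / (z - c) ^ p) < C"
    using tendsto_norm[OF lim] by (rule order_tendstoD) (simp add: C_def)
  with der have "\<forall>\<^sub>F z in at c. (G has_field_derivative g z) (at z) \<and> norm (g z / (z - c) ^ p) < C"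
    by eventually_elim simp
  then obtain d where d: "d > 0" "\<And>z. z \<noteq> c \<Longrightarrow> dist z c < d \<Longrightarrow>
      (G has_field_derivative g z) (at z) \<and> norm (g z / (z - c) ^ p) < C"
    by (auto simp: eventually_at)
  have C0: "C > 0" unfolding C_def by (intro add_nonneg_pos) auto
  have est: "norm ((G z - l) / (z - c) ^ p) \<le> C * norm (z - c)" if z: "z \<noteq> c" "dist z c < d" for z
  proof -
    have "norm (G (c + (z - c)) - l) \<le> (C * norm (z - c) ^ p) * norm (z - c)"
    proof (rule radial_mean_value_limit[where g="\<lambda>v. G (c + v)" and g'="\<lambda>v. g (c + v)"])
      show "((\<lambda>v. G (c + v)) \<longlongrightarrow> l) (at 0)"
        using G by (simp add: LIM_offset_zero_iff)
      fix \<tau> :: real assume \<tau>: "0 < \<tau>" "\<tau> \<le> 1"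
      define v where "v = of_real \<tau> * (z - c)"
      have v0: "v \<noteq> 0" and nv: "norm v \<le> norm (z - c)"
        using z \<tau> by (auto simp: v_def norm_mult intro!: mult_left_le_one_le)
      have dv: "(G has_field_derivative g (c + v)) (at (c + v))"
        and bv: "norm (g (c + v) / v ^ p) < C"
        using d(2)[of "c + v"] v0 nv z by (auto simp: dist_norm)
      from dv have "((\<lambda>v. G (c + v)) has_field_derivative g (c + v)) (at v)"
        using DERIV_shift[of G "g (c + v)" v c] by (simp add: add.commute)
      then show "((\<lambda>v. G (c + v)) has_field_derivative g (c + of_real \<tau> * (z - c)))
            (at (of_real \<tau> * (z - c)))"
        by (simp add: v_def)
      have "norm (g (c + v)) \<le> C * norm v ^ p"
        using bv v0 by (simp add: norm_divide norm_power field_simps)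
      also have "\<dots> \<le> C * norm (z - c) ^ p"
        using C0 nv by (intro mult_left_mono power_mono) auto
      finally show "norm (g (c + of_real \<tau> * (z - c))) \<le> C * norm (z - c) ^ p"
        by (simp add: v_def)
    qed (use z in auto)
    then show ?thesis
      using z by (simp add: norm_divide norm_power field_simps)
  qed
  have "\<forall>\<^sub>F z in at c. norm ((G z - l) / (z - c) ^ p) \<le> C * norm (z - c)"
    unfolding eventually_at using d(1) est by blast
  moreover have "((\<lambda>z. C * norm (z - c)) \<longlongrightarrow> 0) (at c)"
    by (auto intro!: tendsto_eq_intros)
  ultimately show ?thesis
    by (rule Lim_null_comparison)
qed

section \<open>Taylor polynomials and their quotients\<close>

text \<open>The remainder has order \<open>d + 1\<close>, by the bound in Taylor's theorem on a
disc.\<close>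
lemma taylor_poly_remainder:
  assumes h: "h holomorphic_on S" and S: "open S" "c \<in> S"
  shows "((\<lambda>z. (h z - taylor_poly h c d z) / (z - c) ^ d) \<longlongrightarrow> 0) (at c)"
proof -
  obtain r where r: "r > 0" "cball c r \<subseteq> S"
    using S open_contains_cball by blast
  have hol: "(deriv ^^ i) h holomorphic_on S" for i
    using h S by (intro holomorphic_higher_deriv)
  have "bounded ((deriv ^^ Suc d) h ` cball c r)"
    using hol[of "Suc d"] r
    by (intro compact_imp_bounded compact_continuous_image)
       (auto intro: holomorphic_on_imp_continuous_on holomorphic_on_subset)
  then obtain B where B: "\<And>z. z \<in> cball c r \<Longrightarrow> norm ((deriv ^^ Suc d) h z) \<le> B"
    unfolding bounded_iff by blast
  have B0: "B \<ge> 0" using B[of c] r order_trans[OF norm_ge_zero] by auto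
  have est: "norm ((h z - taylor_poly h c d z) / (z - c) ^ d) \<le> B * norm (z - c)"
    if z: "z \<in> cball c r" "z \<noteq> c" for z
  proof -
    have "norm ((deriv ^^ 0) h z - (\<Sum>i\<le>d. (deriv ^^ i) h c * (z - c) ^ i / fact i))
        \<le> B * norm (z - c) ^ Suc d / fact d"
    proof (rule complex_Taylor[where S="cball c r"])
      fix i x assume x: "x \<in> cball c r"
      have "((deriv ^^ i) h has_field_derivative deriv ((deriv ^^ i) h) x) (at x)"
        using hol[of i] S(1) r(2) x by (intro holomorphic_derivI) auto
      then show "((deriv ^^ i) h has_field_derivative (deriv ^^ Suc i) h x) (at x within cball c r)"
        by (simp add: has_field_derivative_at_within)
    qed (use B z r in auto)
    also have "\<dots> \<le> B * norm (z - c) ^ Suc d / 1"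
      using B0 by (intro divide_left_mono) (auto simp: fact_ge_1)
    also have "(\<Sum>i\<le>d. (deriv ^^ i) h c * (z - c) ^ i / fact i) = taylor_poly h c d z"
      by (simp add: taylor_poly_def atMost_atLeast0)
    finally show ?thesis
      using z by (simp add: norm_divide norm_power field_simps)
  qed
  have "\<forall>\<^sub>F z in at c. norm ((h z - taylor_poly h c d z) / (z - c) ^ d) \<le> B * norm (z - c)"
    unfolding eventually_at
    using r(1) est by (intro exI[of _ r]) (auto simp: dist_commute)
  moreover have "((\<lambda>z. B * norm (z - c)) \<longlongrightarrow> 0) (at c)"
    by (auto intro!: tendsto_eq_intros)
  ultimately show ?thesis
    by (rule Lim_null_comparison)
qed

lemma taylor_poly_quotient_at_infinity:
  assumes "d < e"
  shows "((\<lambda>z. taylor_poly h c d z / (z - c) ^ e) \<longlongrightarrow> 0) at_infinity"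
proof -
  have summand: "((\<lambda>z. (deriv ^^ s) h c / fact s * (z - c) ^ s / (z - c) ^ e) \<longlongrightarrow> 0) at_infinity"
    if "s \<in> {0..d}" for s
  proof -
    have "((\<lambda>z. (deriv ^^ s) h c / fact s * inverse (z - c) ^ (e - s))
        \<longlongrightarrow> (deriv ^^ s) h c / fact s * 0 ^ (e - s)) at_infinity"
      by (intro tendsto_intros inverse_shift_at_infinity)
    moreover have "\<forall>\<^sub>F z in at_infinity. (deriv ^^ s) h c / fact s * inverse (z - c) ^ (e - s)
        = (deriv ^^ s) h c / fact s * (z - c) ^ s / (z - c) ^ e"
      using eventually_not_equal_at_infinity[of c]
    proof eventually_elim
      fix z assume "z \<noteq> c"
      moreover have "(z - c) ^ e = (z - c) ^ s * (z - c) ^ (e - s)"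
        using that assms by (simp flip: power_add)
      ultimately show "(deriv ^^ s) h c / fact s * inverse (z - c) ^ (e - s)
          = (deriv ^^ s) h c / fact s * (z - c) ^ s / (z - c) ^ e"
        by (simp add: divide_inverse power_inverse)
    qed
    moreover have "e - s > 0" using that assms by simp
    ultimately show ?thesis
      using Lim_transform_eventually by (simp add: zero_power) 
  qed
  then show ?thesis
    unfolding taylor_poly_def sum_divide_distrib by (intro tendsto_null_sum) auto
qed

lemma eventually_avoids_finite:
  fixes K :: "complex set"
  assumes "finite K"
  shows "\<forall>\<^sub>F z in at_infinity. z \<notin> K"
proof -
  obtain B where "\<And>z. z \<in> K \<Longrightarrow> norm z < B"
    using finite_imp_bounded[OF \<open>finite K\<close>] unfolding bounded_pos_less by blast
  then show ?thesis
    unfolding eventually_at_infinity by (intro exI[of _ B]) force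
qed

section \<open>Means over large circles and limits at infinity\<close>

text \<open>With \<open>w = 1/z\<close> the integral becomes that of a function with a removable
singularity at the origin, and Cauchy's formula evaluates it there. This links a limit at infinity
to an integral over a compact set, and it is used in both directions.\<close>
lemma circle_mean_at_infinity:
  fixes G :: "complex \<Rightarrow> complex"
  assumes r: "0 < r" "r < \<rho>"
    and der: "\<And>z. norm z > r \<Longrightarrow> (G has_field_derivative g z) (at z)"
    and lim: "((\<lambda>z. G z / z) \<longlongrightarrow> 0) at_infinity"
    and int: "((\<lambda>w. G (inverse w) / w) has_contour_integral I) (circlepath 0 (1 / \<rho>))"
  shows "(G \<longlongrightarrow> I / (2 * of_real pi * \<i>)) at_infinity"
proof -
  define h where "h = (\<lambda>w. G (inverse w))"
  define S :: "complex set" where "S = ball 0 (1 / r)"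
  have "h holomorphic_on S - {0}"
  proof (rule holomorphic_onI)
    fix w assume w: "w \<in> S - {0}"
    then have "norm (inverse w) > r"
      using r by (simp add: S_def norm_inverse norm_divide field_simps)
    from DERIV_chain2[OF der[OF this] DERIV_inverse]
    have "(h has_field_derivative g (inverse w) * - (inverse w ^ Suc (Suc 0))) (at w within S - {0})"
      unfolding h_def using w by simp
    then show "h field_differentiable at w within S - {0}"
      unfolding field_differentiable_def by (rule exI)
  qed
  moreover have "((\<lambda>w. (w - 0) * h w) \<longlongrightarrow> 0) (at 0)"
    using lim by (simp add: lim_at_infinity_0 o_def h_def divide_inverse mult.commute)
  ultimately obtain k where k: "k holomorphic_on S" "\<And>w. w \<in> S - {0} \<Longrightarrow> k w = h w"
    using holomorphic_on_extend_lim[of h S 0] r by (auto simp: S_def)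
  have sub: "cball 0 (1 / \<rho>) \<subseteq> S"
  proof
    fix w :: complex assume "w \<in> cball 0 (1 / \<rho>)"
    then have "norm w \<le> 1 / \<rho>" by simp
    also have "\<dots> < 1 / r" using r by (simp add: field_simps)
    finally show "w \<in> S" by (simp add: S_def)
  qed
  have "((\<lambda>u. k u / (u - 0)) has_contour_integral (2 * of_real pi * \<i> * k 0)) (circlepath 0 (1 / \<rho>))"
    using r sub by (intro Cauchy_integral_circlepath_simple holomorphic_on_subset[OF k(1)]) auto
  then have "((\<lambda>w. G (inverse w) / w) has_contour_integral (2 * of_real pi * \<i> * k 0)) (circlepath 0 (1 / \<rho>))"
  proof (rule has_contour_integral_eq)
    fix w assume "w \<in> path_image (circlepath 0 (1 / \<rho>))"
    then have "norm w = 1 / \<rho>" using r by simp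
    then have "w \<in> cball 0 (1 / \<rho>)" "w \<noteq> 0" using r by auto
    then show "k w / (w - 0) = G (inverse w) / w"
      using sub k(2)[of w] by (auto simp: h_def)
  qed
  from has_contour_integral_unique[OF this int]
  have I: "k 0 = I / (2 * of_real pi * \<i>)" by (simp add: field_simps)
  have S0: "open S" "0 \<in> S" using r by (auto simp: S_def)
  have "isCont k 0"
    using continuous_on_interior[OF holomorphic_on_imp_continuous_on[OF k(1)]] S0
    by (metis interior_open)
  then have "(k \<longlongrightarrow> k 0) (at 0)" by (simp add: isCont_def)
  then have "(h \<longlongrightarrow> k 0) (at 0)"
  proof (rule Lim_transform_eventually)
    have "\<forall>\<^sub>F w in at 0. w \<in> S" by (intro eventually_at_in_open' S0)
    moreover have "\<forall>\<^sub>F w in at (0::complex). w \<noteq> 0" by (simp add: eventually_at_filter)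
    ultimately show "\<forall>\<^sub>F w in at 0. k w = h w"
      by eventually_elim (simp add: k(2))
  qed
  then show ?thesis
    unfolding lim_at_infinity_0 I o_def h_def .
qed

section \<open>The derivative of a rational function with prescribed critical points and poles\<close>

locale critical_data =
  fixes M N :: nat and m n :: "nat \<Rightarrow> nat" and a b :: "nat \<Rightarrow> complex"
  assumes m_ge: "\<And>l. l \<in> {1..M} \<Longrightarrow> m l \<ge> 2"
    and inj_a: "inj_on a {1..M}"
    and inj_b: "inj_on b {1..N}"
    and disj: "a ` {1..M} \<inter> b ` {1..N} = {}"
begin

abbreviation crit :: "complex set" where "crit \<equiv> a ` {1..M}"
abbreviation poles :: "complex set" where "poles \<equiv> b ` {1..N}"
abbreviation f :: "complex \<Rightarrow> complex" where "f \<equiv> ratio_prod M N m n a b"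
abbreviation H :: "nat \<Rightarrow> complex \<Rightarrow> complex" where "H \<equiv> H_fun M N m n a b"

lemma f_nonzero: "z \<notin> crit \<Longrightarrow> z \<notin> poles \<Longrightarrow> f z \<noteq> 0"
  by (auto simp: ratio_prod_def)

text \<open>Hence \<open>1/f\<close> is \<open>H l\<close> divided by a power of \<open>z - a
l\<close>, which is where the functions \<open>H l\<close> of the theorem come from.\<close>
lemma f_eq_H:
  assumes "l \<in> {1..M}" "z \<notin> crit"
  shows "f z = (z - a l) ^ (m l - 1) / H l z"
proof -
  have "(\<Prod>k=1..M. (z - a k) ^ (m k - 1))
      = (z - a l) ^ (m l - 1) * (\<Prod>k\<in>{1..M} - {l}. (z - a k) ^ (m k - 1))"
    using assms by (intro prod.remove) auto
  then show ?thesis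
    by (simp only: ratio_prod_def H_fun_def divide_divide_eq_right)
qed

lemma H_holomorphic: "H l holomorphic_on - (a ` ({1..M} - {l}))"
  unfolding H_fun_def by (intro holomorphic_intros) auto

lemma H_at_own_point:
  assumes "l \<in> {1..M}"
  shows "open (- (a ` ({1..M} - {l})))" "a l \<in> - (a ` ({1..M} - {l}))" "H l (a l) \<noteq> 0"
    "isCont (H l) (a l)"
proof -
  show 1: "open (- (a ` ({1..M} - {l})))"
    by (intro open_Compl finite_imp_closed) auto
  show 2: "a l \<in> - (a ` ({1..M} - {l}))"
    using inj_onD[OF inj_a, of l] assms by blast
  then have "a l \<noteq> a k" if "k \<in> {1..M} - {l}" for k
    using that by blast
  then have "(\<Prod>k\<in>{1..M} - {l}. (a l - a k) ^ (m k - 1)) \<noteq> 0"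
    by (subst prod_zero_iff) auto
  moreover have "a l \<noteq> b j" if "j \<in> {1..N}" for j
    using that disj assms by blast
  then have "(\<Prod>j=1..N. (a l - b j) ^ (n j + 1)) \<noteq> 0"
    by (subst prod_zero_iff) auto
  ultimately show "H l (a l) \<noteq> 0"
    by (simp only: H_fun_def divide_eq_0_iff not_False_eq_True simp_thms)
  show "isCont (H l) (a l)"
    using continuous_on_interior[OF holomorphic_on_imp_continuous_on[OF H_holomorphic]] 1 2
    by (metis interior_open)
qed

lemma f_zero_order:
  assumes "l \<in> {1..M}"
  shows "((\<lambda>z. f z / (z - a l) ^ (m l - 1)) \<longlongrightarrow> inverse (H l (a l))) (at (a l))"
proof (rule Lim_transform_eventually)
  show "((\<lambda>z. inverse (H l z)) \<longlongrightarrow> inverse (H l (a l))) (at (a l))"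
    using H_at_own_point[OF assms] by (intro tendsto_inverse) (auto simp: isCont_def)
  have "\<forall>\<^sub>F z in at (a l). z \<notin> crit"
  proof -
    have "\<forall>\<^sub>F z in at (a l). z \<in> - (a ` ({1..M} - {l}))"
      by (intro eventually_at_in_open' H_at_own_point assms)
    moreover have "\<forall>\<^sub>F z in at (a l). z \<noteq> a l"
      by (simp add: eventually_at_filter)
    ultimately show ?thesis by eventually_elim auto
  qed
  then show "\<forall>\<^sub>F z in at (a l). inverse (H l z) = f z / (z - a l) ^ (m l - 1)"
  proof eventually_elim
    fix z assume z: "z \<notin> crit"
    then have "z \<noteq> a l" using assms by blast
    with f_eq_H[OF assms z] show "inverse (H l z) = f z / (z - a l) ^ (m l - 1)"
      by (simp add: divide_inverse)
  qed
qed

lemma f_pole_order: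
  assumes "j \<in> {1..N}"
  shows "\<exists>c. c \<noteq> 0 \<and> ((\<lambda>z. f z * (z - b j) ^ (n j + 1)) \<longlongrightarrow> c) (at (b j))"
proof -
  define h where "h = (\<lambda>z. (\<Prod>l=1..M. (z - a l) ^ (m l - 1)) / (\<Prod>i\<in>{1..N}-{j}. (z - b i) ^ (n i + 1)))"
  have "b j \<noteq> b i" if "i \<in> {1..N} - {j}" for i
    using that assms inj_onD[OF inj_b, of j i] by blast
  then have den: "(\<Prod>i\<in>{1..N}-{j}. (b j - b i) ^ (n i + 1)) \<noteq> 0"
    by (subst prod_zero_iff) auto
  have "b j \<noteq> a l" if "l \<in> {1..M}" for l
    using that assms disj by blast
  then have "(\<Prod>l=1..M. (b j - a l) ^ (m l - 1)) \<noteq> 0"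
    by (subst prod_zero_iff) auto
  with den have "h (b j) \<noteq> 0" by (simp add: h_def)
  moreover have "((\<lambda>z. f z * (z - b j) ^ (n j + 1)) \<longlongrightarrow> h (b j)) (at (b j))"
  proof (rule Lim_transform_eventually)
    show "(h \<longlongrightarrow> h (b j)) (at (b j))"
      unfolding h_def by (intro tendsto_intros den)
    have "\<forall>\<^sub>F z in at (b j). z \<noteq> b j"
      by (simp add: eventually_at_filter)
    then show "\<forall>\<^sub>F z in at (b j). h z = f z * (z - b j) ^ (n j + 1)"
    proof eventually_elim
      fix z assume z: "z \<noteq> b j"
      have "(\<Prod>i=1..N. (z - b i) ^ (n i + 1))
          = (z - b j) ^ (n j + 1) * (\<Prod>i\<in>{1..N} - {j}. (z - b i) ^ (n i + 1))"
        using assms by (intro prod.remove) auto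
      then show "h z = f z * (z - b j) ^ (n j + 1)"
        unfolding h_def ratio_prod_def using z by (simp only: divide_simps) simp
    qed
  qed
  ultimately show ?thesis by (intro exI[of _ "h (b j)"] conjI)
qed

text \<open>Both degrees are kept as separate powers, because their difference may have either
sign.\<close>
lemma f_at_infinity:
  "((\<lambda>z. f z * z ^ total_pole N n / z ^ total_crit M m) \<longlongrightarrow> 1) at_infinity"
proof (rule Lim_transform_eventually)
  have "((\<lambda>z. (\<Prod>j=1..N. (z / (z - b j)) ^ (n j + 1)) / (\<Prod>l=1..M. (z / (z - a l)) ^ (m l - 1)))
      \<longlongrightarrow> (\<Prod>j=1..N. 1 ^ (n j + 1)) / (\<Prod>l=1..M. 1 ^ (m l - 1))) at_infinity"
    by (intro tendsto_intros quotient_shift_at_infinity) simp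
  then show "((\<lambda>z. (\<Prod>j=1..N. (z / (z - b j)) ^ (n j + 1)) / (\<Prod>l=1..M. (z / (z - a l)) ^ (m l - 1)))
      \<longlongrightarrow> 1) at_infinity"
    by simp
  have "finite (insert 0 crit)" by simp
  then have "\<forall>\<^sub>F z in at_infinity. z \<notin> insert 0 crit"
    by (rule eventually_avoids_finite)
  then show "\<forall>\<^sub>F z in at_infinity.
      (\<Prod>j=1..N. (z / (z - b j)) ^ (n j + 1)) / (\<Prod>l=1..M. (z / (z - a l)) ^ (m l - 1))
      = f z * z ^ total_pole N n / z ^ total_crit M m"
    by eventually_elim
      (simp add: ratio_prod_def total_pole_def total_crit_def power_sum prod_dividef power_divide
        del: power_Suc)
qed

end

section \<open>Partial fraction expansion of the variation\<close>

text \<open>The functions \<open>G\<close> and \<open>g\<close> stand for the derivatives of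
\<open>R\<close> and of \<open>f\<close> in the parameter. The formula for \<open>g\<close> is
required off the critical points only; there the division by \<open>z - a l\<close> gives the wrong
value 0 if \<open>m l = 2\<close>. The circle of radius \<open>1/\<rho>\<close> in the coordinate
\<open>1/z\<close> encloses infinity and no pole.\<close>
locale critical_variation = critical_data +
  fixes a' b' :: "nat \<Rightarrow> complex" and G g :: "complex \<Rightarrow> complex" and r \<rho> :: real
  assumes G_deriv: "\<And>z. z \<notin> poles \<Longrightarrow> (G has_field_derivative g z) (at z)"
    and g_eq: "\<And>z. z \<notin> crit \<Longrightarrow> z \<notin> poles \<Longrightarrow> g z = f z *
        ((\<Sum>j=1..N. of_nat (n j + 1) * b' j / (z - b j)) - (\<Sum>l=1..M. of_nat (m l - 1) * a' l / (z - a l)))"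
    and centered: "(\<Sum>l=1..M. of_nat (m l - 1) * a' l) = (\<Sum>j=1..N. of_nat (n j + 1) * b' j)"
    and radii: "0 < r" "r < \<rho>" "\<And>z. z \<in> poles \<Longrightarrow> norm z \<le> r"
    and mean_zero: "total_crit M m \<le> total_pole N n \<Longrightarrow>
      ((\<lambda>w. G (inverse w) / w) has_contour_integral 0) (circlepath 0 (1 / \<rho>))"
begin

definition L :: "complex \<Rightarrow> complex" where
  "L z = (\<Sum>j=1..N. of_nat (n j + 1) * b' j / (z - b j)) - (\<Sum>l=1..M. of_nat (m l - 1) * a' l / (z - a l))"

lemma g_eq_L: "z \<notin> crit \<Longrightarrow> z \<notin> poles \<Longrightarrow> g z = f z * L z"
  unfolding L_def by (rule g_eq)

lemma eventually_generic: "\<forall>\<^sub>F z in at_infinity. z \<notin> crit \<and> z \<notin> poles"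
  using eventually_avoids_finite[of "crit \<union> poles"] by simp

text \<open>Since \<open>z\<^sup>2/(z - c) = z + c z/(z - c)\<close>, the terms of order
\<open>z\<close> add up to the differentiated centering condition, so that they cancel.\<close>
lemma L_at_infinity: "\<exists>c. ((\<lambda>z. L z * z ^ 2) \<longlongrightarrow> c) at_infinity"
proof (intro exI, rule Lim_transform_eventually)
  let ?c = "(\<Sum>j=1..N. of_nat (n j + 1) * b' j * b j) - (\<Sum>l=1..M. of_nat (m l - 1) * a' l * a l)"
  let ?h = "\<lambda>z. (\<Sum>j=1..N. of_nat (n j + 1) * b' j * (b j * (z / (z - b j))))
      - (\<Sum>l=1..M. of_nat (m l - 1) * a' l * (a l * (z / (z - a l))))"
  show "(?h \<longlongrightarrow> (\<Sum>j=1..N. of_nat (n j + 1) * b' j * (b j * 1))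
      - (\<Sum>l=1..M. of_nat (m l - 1) * a' l * (a l * 1))) at_infinity"
    by (intro tendsto_intros quotient_shift_at_infinity)
  show "\<forall>\<^sub>F z in at_infinity. ?h z = L z * z ^ 2"
    using eventually_generic
  proof eventually_elim
    fix z assume z: "z \<notin> crit \<and> z \<notin> poles"
    have split: "z\<^sup>2 / (z - c) = c * (z / (z - c)) + z" if "z \<noteq> c" for c
      using that by (simp add: field_simps power2_eq_square)
    have "(\<Sum>j=1..N. of_nat (n j + 1) * b' j / (z - b j)) * z\<^sup>2
        = (\<Sum>j=1..N. of_nat (n j + 1) * b' j * (z\<^sup>2 / (z - b j)))"
      by (simp add: sum_distrib_right)
    also have "\<dots> = (\<Sum>j=1..N. of_nat (n j + 1) * b' j * (b j * (z / (z - b j))) + of_nat (n j + 1) * b' j * z)"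
      using z by (intro sum.cong refl) (subst split, auto simp: ring_distribs)
    finally have 1: "(\<Sum>j=1..N. of_nat (n j + 1) * b' j / (z - b j)) * z\<^sup>2
      = (\<Sum>j=1..N. of_nat (n j + 1) * b' j * (b j * (z / (z - b j)))) + (\<Sum>j=1..N. of_nat (n j + 1) * b' j) * z"
      by (simp only: sum.distrib sum_distrib_right)
    have "(\<Sum>l=1..M. of_nat (m l - 1) * a' l / (z - a l)) * z\<^sup>2
        = (\<Sum>l=1..M. of_nat (m l - 1) * a' l * (z\<^sup>2 / (z - a l)))"
      by (simp add: sum_distrib_right)
    also have "\<dots> = (\<Sum>l=1..M. of_nat (m l - 1) * a' l * (a l * (z / (z - a l))) + of_nat (m l - 1) * a' l * z)"
      using z by (intro sum.cong refl) (subst split, auto simp: ring_distribs)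
    finally have 2: "(\<Sum>l=1..M. of_nat (m l - 1) * a' l / (z - a l)) * z\<^sup>2
      = (\<Sum>l=1..M. of_nat (m l - 1) * a' l * (a l * (z / (z - a l)))) + (\<Sum>l=1..M. of_nat (m l - 1) * a' l) * z"
      by (simp only: sum.distrib sum_distrib_right)
    show "?h z = L z * z ^ 2"
      unfolding L_def left_diff_distrib 1 2 centered by simp
  qed
qed

lemma L_at_pole:
  assumes j: "j \<in> {1..N}"
  shows "((\<lambda>z. L z * (z - b j)) \<longlongrightarrow> of_nat (n j + 1) * b' j) (at (b j))"
proof -
  define h where "h = (\<lambda>z. (\<Sum>i\<in>{1..N}-{j}. of_nat (n i + 1) * b' i / (z - b i))
    - (\<Sum>l=1..M. of_nat (m l - 1) * a' l / (z - a l)))"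
  have ne: "b j - b i \<noteq> 0" if "i \<in> {1..N} - {j}" for i
    using that j inj_onD[OF inj_b, of j i] by force
  have ne': "b j - a l \<noteq> 0" if "l \<in> {1..M}" for l
    using that j disj by force
  have "((\<lambda>z. of_nat (n j + 1) * b' j + (z - b j) * h z)
      \<longlongrightarrow> of_nat (n j + 1) * b' j + (b j - b j) * h (b j)) (at (b j))"
    unfolding h_def by (intro tendsto_intros ne ne')
  then have "((\<lambda>z. of_nat (n j + 1) * b' j + (z - b j) * h z) \<longlongrightarrow> of_nat (n j + 1) * b' j) (at (b j))"
    by simp
  then show ?thesis
  proof (rule Lim_transform_eventually)
    have "\<forall>\<^sub>F z in at (b j). z \<noteq> b j"
      by (simp add: eventually_at_filter)
    then show "\<forall>\<^sub>F z in at (b j). of_nat (n j + 1) * b' j + (z - b j) * h z = L z * (z - b j)"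
    proof eventually_elim
      fix z assume "z \<noteq> b j"
      have "(\<Sum>i=1..N. of_nat (n i + 1) * b' i / (z - b i)) = of_nat (n j + 1) * b' j / (z - b j)
          + (\<Sum>i\<in>{1..N}-{j}. of_nat (n i + 1) * b' i / (z - b i))"
        using j by (intro sum.remove) auto
      then have "L z = of_nat (n j + 1) * b' j / (z - b j) + h z"
        unfolding L_def h_def by (simp only: add_diff_eq)
      then show "of_nat (n j + 1) * b' j + (z - b j) * h z = L z * (z - b j)"
        using \<open>z \<noteq> b j\<close> by (simp add: distrib_right mult.commute[of "z - b j"] del: of_nat_add of_nat_Suc)
    qed
  qed
qed

lemma L_at_crit:
  assumes l: "l \<in> {1..M}"
  shows "((\<lambda>z. L z * (z - a l)) \<longlongrightarrow> - (of_nat (m l - 1) * a' l)) (at (a l))"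
proof -
  define h where "h = (\<lambda>z. (\<Sum>j=1..N. of_nat (n j + 1) * b' j / (z - b j))
    - (\<Sum>k\<in>{1..M}-{l}. of_nat (m k - 1) * a' k / (z - a k)))"
  have ne: "a l - a k \<noteq> 0" if "k \<in> {1..M} - {l}" for k
    using that l inj_onD[OF inj_a, of l k] by force
  have ne': "a l - b j \<noteq> 0" if "j \<in> {1..N}" for j
    using that l disj by force
  have "((\<lambda>z. (z - a l) * h z - of_nat (m l - 1) * a' l)
      \<longlongrightarrow> (a l - a l) * h (a l) - of_nat (m l - 1) * a' l) (at (a l))"
    unfolding h_def by (intro tendsto_intros ne ne')
  then have "((\<lambda>z. (z - a l) * h z - of_nat (m l - 1) * a' l) \<longlongrightarrow> - (of_nat (m l - 1) * a' l)) (at (a l))"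
    by simp
  then show ?thesis
  proof (rule Lim_transform_eventually)
    have "\<forall>\<^sub>F z in at (a l). z \<noteq> a l"
      by (simp add: eventually_at_filter)
    then show "\<forall>\<^sub>F z in at (a l). (z - a l) * h z - of_nat (m l - 1) * a' l = L z * (z - a l)"
    proof eventually_elim
      fix z assume "z \<noteq> a l"
      have "(\<Sum>k=1..M. of_nat (m k - 1) * a' k / (z - a k)) = of_nat (m l - 1) * a' l / (z - a l)
          + (\<Sum>k\<in>{1..M}-{l}. of_nat (m k - 1) * a' k / (z - a k))"
        using l by (intro sum.remove) auto
      then have "L z = h z - of_nat (m l - 1) * a' l / (z - a l)"
        unfolding L_def h_def by simp
      then show "(z - a l) * h z - of_nat (m l - 1) * a' l = L z * (z - a l)"
        using \<open>z \<noteq> a l\<close> by (simp add: left_diff_distrib[of "h z"] mult.commute[of "z - a l"])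
    qed
  qed
qed

lemma eventually_G_deriv_at_infinity:
  obtains r' where "\<And>z. norm z \<ge> r' \<Longrightarrow> (G has_field_derivative g z) (at z)"
    "\<And>z. norm z \<ge> r' \<Longrightarrow> g z = f z * L z" "r' > 0"
proof -
  from eventually_generic obtain r' where r: "\<And>z. norm z \<ge> r' \<Longrightarrow> z \<notin> crit \<and> z \<notin> poles"
    unfolding eventually_at_infinity by blast
  show ?thesis
  proof (rule that[of "max r' 1"])
    fix z :: complex assume "norm z \<ge> max r' 1"
    then have z: "z \<notin> crit" "z \<notin> poles" using r[of z] by auto
    then show "(G has_field_derivative g z) (at z)" by (intro G_deriv)
    show "g z = f z * L z" by (intro g_eq_L z)
  qed simp
qed

text \<open>If \<open>f\<close> does not grow, then \<open>G\<close> vanishes at infinity by the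
mean value condition, and it decays faster than \<open>f\<close> because \<open>L =
O(z\<^sup>-\<^sup>2)\<close>. If \<open>f\<close> grows, an additive constant in \<open>G\<close> is
harmless, and the growth lemma applies.\<close>
lemma quotient_at_infinity: "((\<lambda>z. G z / f z) \<longlongrightarrow> 0) at_infinity"
proof (cases "total_crit M m \<le> total_pole N n")
  case True
  define p where "p = total_pole N n - total_crit M m"
  have ne0: "\<forall>\<^sub>F z::complex in at_infinity. z \<noteq> 0"
    by (rule eventually_not_equal_at_infinity)
  have fp: "((\<lambda>z. f z * z ^ p) \<longlongrightarrow> 1) at_infinity"
  proof (rule Lim_transform_eventually[OF f_at_infinity])
    show "\<forall>\<^sub>F z in at_infinity. f z * z ^ total_pole N n / z ^ total_crit M m = f z * z ^ p"
      using ne0 by eventually_elim (use True in \<open>simp add: p_def power_diff\<close>)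
  qed
  obtain c where c: "((\<lambda>z. L z * z ^ 2) \<longlongrightarrow> c) at_infinity"
    using L_at_infinity by blast
  obtain r' where r: "\<And>z. norm z \<ge> r' \<Longrightarrow> (G has_field_derivative g z) (at z)"
    "\<And>z. norm z \<ge> r' \<Longrightarrow> g z = f z * L z" "r' > 0"
    using eventually_G_deriv_at_infinity by blast
  have G0: "(G \<longlongrightarrow> 0) at_infinity"
  proof -
    have "((\<lambda>z. (f z * z ^ p) * (L z * z ^ 2) * inverse z ^ (p + 2)) \<longlongrightarrow> 1 * c * 0 ^ (p + 2)) at_infinity"
      by (intro tendsto_intros fp c tendsto_inverse_0)
    then have "((\<lambda>z. (f z * z ^ p) * (L z * z ^ 2) * inverse z ^ (p + 2)) \<longlongrightarrow> 0) at_infinity"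
      by simp
    then have "((\<lambda>z. g z / z ^ 0) \<longlongrightarrow> 0) at_infinity"
    proof (rule Lim_transform_eventually)
      show "\<forall>\<^sub>F z in at_infinity. (f z * z ^ p) * (L z * z ^ 2) * inverse z ^ (p + 2) = g z / z ^ 0"
        unfolding eventually_at_infinity
      proof (intro exI allI impI)
        fix z :: complex assume z: "norm z \<ge> r'"
        then have "z \<noteq> 0" using r(3) by auto
        then have "z ^ p * z ^ 2 * inverse z ^ (p + 2) = 1"
          by (simp only: power_inverse power_add[symmetric] right_inverse power_not_zero not_False_eq_True)
        then have "(f z * z ^ p) * (L z * z ^ 2) * inverse z ^ (p + 2) = f z * L z * 1"
          by (metis mult.assoc mult.left_commute)
        then show "(f z * z ^ p) * (L z * z ^ 2) * inverse z ^ (p + 2) = g z / z ^ 0"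
          using r(2)[OF z] by simp
      qed
    qed
    from primitive_growth_at_infinity[OF r(1) this]
    have "((\<lambda>z. G z / z) \<longlongrightarrow> 0) at_infinity" by simp
    from circle_mean_at_infinity[OF radii(1,2) _ this mean_zero[OF True], of g]
    show ?thesis
      using G_deriv radii(3) by fastforce
  qed
  have "((\<lambda>z. norm ((f z * z ^ p) * (L z * z ^ 2))) \<longlongrightarrow> norm (1 * c)) at_infinity"
    by (intro tendsto_intros fp c)
  then have "\<forall>\<^sub>F z in at_infinity. norm ((f z * z ^ p) * (L z * z ^ 2)) < norm c + 1"
    by (rule order_tendstoD) simp
  then obtain s where s: "\<And>z. norm z \<ge> s \<Longrightarrow> norm ((f z * z ^ p) * (L z * z ^ 2)) < norm c + 1"
    unfolding eventually_at_infinity by blast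
  have "((\<lambda>z. G z * z ^ p) \<longlongrightarrow> 0) at_infinity"
  proof (rule primitive_decay_at_infinity[where r="max r' s" and g'=g])
    fix z :: complex assume z: "norm z \<ge> max r' s"
    then show "(G has_field_derivative g z) (at z)" by (intro r) simp
    have "norm (g z) * norm z ^ (p + 2) = norm ((f z * z ^ p) * (L z * z ^ 2))"
      using r(2)[of z] z by (simp add: norm_mult norm_power power_add power2_eq_square mult_ac)
    then show "norm (g z) * norm z ^ (p + 2) \<le> norm c + 1"
      using s[of z] z by simp
  qed (rule G0)
  from tendsto_divide[OF this fp]
  have "((\<lambda>z. (G z * z ^ p) / (f z * z ^ p)) \<longlongrightarrow> 0) at_infinity"
    by simp
  then show ?thesis
  proof (rule Lim_transform_eventually)
    show "\<forall>\<^sub>F z in at_infinity. (G z * z ^ p) / (f z * z ^ p) = G z / f z"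
      using ne0 by eventually_elim simp
  qed
next
  case False
  define k where "k = total_crit M m - total_pole N n - 1"
  have ne0: "\<forall>\<^sub>F z::complex in at_infinity. z \<noteq> 0"
    by (rule eventually_not_equal_at_infinity)
  have k: "total_crit M m = total_pole N n + Suc k"
    using False by (simp add: k_def)
  have fk: "((\<lambda>z. f z / z ^ Suc k) \<longlongrightarrow> 1) at_infinity"
  proof (rule Lim_transform_eventually[OF f_at_infinity])
    show "\<forall>\<^sub>F z in at_infinity. f z * z ^ total_pole N n / z ^ total_crit M m = f z / z ^ Suc k"
      using ne0 by eventually_elim (simp add: k power_add)
  qed
  obtain c where c: "((\<lambda>z. L z * z ^ 2) \<longlongrightarrow> c) at_infinity"
    using L_at_infinity by blast
  obtain r' where r: "\<And>z. norm z \<ge> r' \<Longrightarrow> (G has_field_derivative g z) (at z)"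
    "\<And>z. norm z \<ge> r' \<Longrightarrow> g z = f z * L z" "r' > 0"
    using eventually_G_deriv_at_infinity by blast
  have "((\<lambda>z. G z / z ^ Suc k) \<longlongrightarrow> 0) at_infinity"
  proof (rule primitive_growth_at_infinity[OF r(1)])
    have "((\<lambda>z. (f z / z ^ Suc k) * (L z * z ^ 2) * inverse z) \<longlongrightarrow> 1 * c * 0) at_infinity"
      by (intro tendsto_intros fk c tendsto_inverse_0)
    then have "((\<lambda>z. (f z / z ^ Suc k) * (L z * z ^ 2) * inverse z) \<longlongrightarrow> 0) at_infinity"
      by simp
    then show "((\<lambda>z. g z / z ^ k) \<longlongrightarrow> 0) at_infinity"
    proof (rule Lim_transform_eventually)
      show "\<forall>\<^sub>F z in at_infinity. (f z / z ^ Suc k) * (L z * z ^ 2) * inverse z = g z / z ^ k"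
        unfolding eventually_at_infinity
      proof (intro exI allI impI)
        fix z :: complex assume z: "norm z \<ge> r'"
        then have "z \<noteq> 0" using r(3) by auto
        then show "(f z / z ^ Suc k) * (L z * z ^ 2) * inverse z = g z / z ^ k"
          using r(2)[OF z] by (simp add: field_simps power2_eq_square)
      qed
    qed
  qed
  from tendsto_divide[OF this fk]
  have "((\<lambda>z. (G z / z ^ Suc k) / (f z / z ^ Suc k)) \<longlongrightarrow> 0) at_infinity"
    by simp
  then show ?thesis
  proof (rule Lim_transform_eventually)
    show "\<forall>\<^sub>F z in at_infinity. (G z / z ^ Suc k) / (f z / z ^ Suc k) = G z / f z"
      using ne0 by eventually_elim simp
  qed
qed

lemma eventually_generic_at: "\<forall>\<^sub>F z in at c. z \<notin> crit \<and> z \<notin> poles"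
proof -
  have "finite ((crit \<union> poles) - {c})" by simp
  then have "open (- ((crit \<union> poles) - {c}))"
    by (intro open_Compl finite_imp_closed)
  then have "\<forall>\<^sub>F z in at c. z \<in> - ((crit \<union> poles) - {c})"
    by (rule eventually_at_in_open') simp
  moreover have "\<forall>\<^sub>F z in at c. z \<noteq> c"
    by (simp add: eventually_at_filter)
  ultimately show ?thesis by eventually_elim simp
qed

text \<open>The derivative \<open>g\<close> has a pole of order at most \<open>n j + 2\<close>, so
\<open>G\<close> is \<open>o\<close> of that order, whereas \<open>f\<close> has a pole of exact
order \<open>n j + 1\<close>.\<close>
lemma quotient_at_pole:
  assumes j: "j \<in> {1..N}"
  shows "((\<lambda>z. (z - b j) * (G z / f z)) \<longlongrightarrow> 0) (at (b j))"
proof -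
  obtain c where c: "c \<noteq> 0" "((\<lambda>z. f z * (z - b j) ^ (n j + 1)) \<longlongrightarrow> c) (at (b j))"
    using f_pole_order[OF j] by blast
  have "((\<lambda>z. G z * (z - b j) ^ (n j + 2)) \<longlongrightarrow> 0) (at (b j))"
  proof (rule primitive_growth_at_point)
    show "\<forall>\<^sub>F z in at (b j). (G has_field_derivative g z) (at z)"
      using eventually_generic_at by eventually_elim (simp add: G_deriv)
    have "((\<lambda>z. (f z * (z - b j) ^ (n j + 1)) * (L z * (z - b j)))
        \<longlongrightarrow> c * (of_nat (n j + 1) * b' j)) (at (b j))"
      by (intro tendsto_mult c L_at_pole j)
    then show "((\<lambda>z. g z * (z - b j) ^ (n j + 2)) \<longlongrightarrow> c * (of_nat (n j + 1) * b' j)) (at (b j))"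
    proof (rule Lim_transform_eventually)
      show "\<forall>\<^sub>F z in at (b j). (f z * (z - b j) ^ (n j + 1)) * (L z * (z - b j)) = g z * (z - b j) ^ (n j + 2)"
        using eventually_generic_at by eventually_elim (simp add: g_eq_L)
    qed
  qed
  from tendsto_divide[OF this c(2,1)]
  have "((\<lambda>z. (G z * (z - b j) ^ (n j + 2)) / (f z * (z - b j) ^ (n j + 1))) \<longlongrightarrow> 0) (at (b j))"
    by simp
  then show ?thesis
  proof (rule Lim_transform_eventually)
    have "\<forall>\<^sub>F z in at (b j). z \<noteq> b j"
      by (simp add: eventually_at_filter)
    then show "\<forall>\<^sub>F z in at (b j). (G z * (z - b j) ^ (n j + 2)) / (f z * (z - b j) ^ (n j + 1))
        = (z - b j) * (G z / f z)"
      by eventually_elim simp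
  qed
qed

text \<open>At \<open>a l\<close> this is the principal part of \<open>G / f\<close>.\<close>
definition principal :: "nat \<Rightarrow> complex \<Rightarrow> complex" where
  "principal l z = taylor_poly (H l) (a l) (m l - 2) z / (z - a l) ^ (m l - 1) * G (a l)"

text \<open>The difference splits into \<open>H l\<close> times \<open>G - G(a l)\<close> and
\<open>G(a l)\<close> times the Taylor remainder of \<open>H l\<close>, each divided by a power of
\<open>z - a l\<close> that it cancels.\<close>
lemma quotient_at_crit:
  assumes l: "l \<in> {1..M}"
  shows "((\<lambda>z. (z - a l) * (G z / f z - principal l z)) \<longlongrightarrow> 0) (at (a l))"
proof -
  define e where "e = m l - 2"
  have e: "m l - Suc 0 = Suc e" using m_ge[OF l] by (simp add: e_def)
  have al: "a l \<notin> poles" using l disj by blast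
  have ne: "\<forall>\<^sub>F z in at (a l). z \<noteq> a l"
    by (simp add: eventually_at_filter)
  have "((\<lambda>z. (G z - G (a l)) / (z - a l) ^ e) \<longlongrightarrow> 0) (at (a l))"
  proof (rule primitive_zero_order)
    show "\<forall>\<^sub>F z in at (a l). (G has_field_derivative g z) (at z)"
      using eventually_generic_at by eventually_elim (simp add: G_deriv)
    show "(G \<longlongrightarrow> G (a l)) (at (a l))"
      using DERIV_isCont[OF G_deriv[OF al]] by (simp add: isCont_def)
    show "((\<lambda>z. g z / (z - a l) ^ e) \<longlongrightarrow> inverse (H l (a l)) * - (of_nat (m l - 1) * a' l)) (at (a l))"
    proof (rule Lim_transform_eventually)
      show "((\<lambda>z. (f z / (z - a l) ^ (m l - 1)) * (L z * (z - a l)))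
          \<longlongrightarrow> inverse (H l (a l)) * - (of_nat (m l - 1) * a' l)) (at (a l))"
        by (intro tendsto_mult f_zero_order L_at_crit l)
      show "\<forall>\<^sub>F z in at (a l). (f z / (z - a l) ^ (m l - 1)) * (L z * (z - a l)) = g z / (z - a l) ^ e"
        using eventually_generic_at ne by eventually_elim (simp add: g_eq_L e)
    qed
  qed
  moreover have "((\<lambda>z. (H l z - taylor_poly (H l) (a l) e z) / (z - a l) ^ e) \<longlongrightarrow> 0) (at (a l))"
    by (intro taylor_poly_remainder[OF H_holomorphic] H_at_own_point l)
  moreover have "(H l \<longlongrightarrow> H l (a l)) (at (a l))"
    using H_at_own_point(4)[OF l] by (simp add: isCont_def)
  ultimately have "((\<lambda>z. H l z * ((G z - G (a l)) / (z - a l) ^ e)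
        + G (a l) * ((H l z - taylor_poly (H l) (a l) e z) / (z - a l) ^ e))
      \<longlongrightarrow> H l (a l) * 0 + G (a l) * 0) (at (a l))"
    by (intro tendsto_intros)
  then have "((\<lambda>z. H l z * ((G z - G (a l)) / (z - a l) ^ e)
        + G (a l) * ((H l z - taylor_poly (H l) (a l) e z) / (z - a l) ^ e)) \<longlongrightarrow> 0) (at (a l))"
    by simp
  then show ?thesis
  proof (rule Lim_transform_eventually)
    show "\<forall>\<^sub>F z in at (a l). H l z * ((G z - G (a l)) / (z - a l) ^ e)
        + G (a l) * ((H l z - taylor_poly (H l) (a l) e z) / (z - a l) ^ e)
        = (z - a l) * (G z / f z - principal l z)"
      using eventually_generic_at ne
    proof eventually_elim
      fix z assume z: "z \<notin> crit \<and> z \<notin> poles" "z \<noteq> a l"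
      have "(z - a l) * (G z / f z - principal l z)
          = G z * H l z / (z - a l) ^ e - G (a l) * taylor_poly (H l) (a l) e z / (z - a l) ^ e"
        using z f_eq_H[OF l, of z] by (simp add: principal_def e e_def[symmetric] right_diff_distrib)
      also have "\<dots> = H l z * ((G z - G (a l)) / (z - a l) ^ e)
        + G (a l) * ((H l z - taylor_poly (H l) (a l) e z) / (z - a l) ^ e)"
        by (simp add: diff_divide_distrib ring_distribs mult.commute)
      finally show "H l z * ((G z - G (a l)) / (z - a l) ^ e)
        + G (a l) * ((H l z - taylor_poly (H l) (a l) e z) / (z - a l) ^ e)
        = (z - a l) * (G z / f z - principal l z)" by simp
    qed
  qed
qed

lemma principal_holomorphic: "a l \<notin> S \<Longrightarrow> principal l holomorphic_on S"
  unfolding principal_def taylor_poly_def by (intro holomorphic_intros) auto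

lemma principal_isCont: "c \<noteq> a l \<Longrightarrow> ((\<lambda>z. principal l z) \<longlongrightarrow> principal l c) (at c)"
  unfolding principal_def taylor_poly_def by (intro tendsto_intros) auto

theorem quotient_eq_principal_parts:
  assumes z: "z \<notin> crit" "z \<notin> poles"
  shows "G z / f z = (\<Sum>l=1..M. taylor_poly (H l) (a l) (m l - 2) z / (z - a l) ^ (m l - 1) * G (a l))"
proof -
  define E where "E = (\<lambda>z. G z / f z - (\<Sum>l=1..M. principal l z))"
  have "E z = 0"
  proof (rule Liouville_finite_singularities[where E=E and K="crit \<union> poles"])
    show "finite (crit \<union> poles)" by simp
    have "G holomorphic_on - (crit \<union> poles)"
    proof (rule holomorphic_onI)
      fix x assume "x \<in> - (crit \<union> poles)"
      then have "(G has_field_derivative g x) (at x within - (crit \<union> poles))"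
        by (intro has_field_derivative_at_within[OF G_deriv]) simp
      then show "G field_differentiable at x within - (crit \<union> poles)"
        unfolding field_differentiable_def by (rule exI)
    qed
    moreover have "f holomorphic_on - (crit \<union> poles)"
      unfolding ratio_prod_def by (intro holomorphic_intros) auto
    ultimately show "E holomorphic_on - (crit \<union> poles)"
      unfolding E_def using f_nonzero by (intro holomorphic_intros principal_holomorphic) auto
    show "((\<lambda>z. (z - c) * E z) \<longlongrightarrow> 0) (at c)" if "c \<in> crit \<union> poles" for c
      using that
    proof
      assume "c \<in> crit"
      then obtain l where l: "l \<in> {1..M}" "c = a l" by (elim imageE)
      have "a l \<noteq> a k" if "k \<in> {1..M} - {l}" for k
        using that l inj_onD[OF inj_a, of l k] by force
      then have "((\<lambda>z. (z - c) * (G z / f z - principal l z) - (z - c) * (\<Sum>k\<in>{1..M}-{l}. principal k z))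
          \<longlongrightarrow> 0 - (c - c) * (\<Sum>k\<in>{1..M}-{l}. principal k c)) (at c)"
        unfolding l(2) by (intro tendsto_intros quotient_at_crit l principal_isCont)
      moreover have "(z - c) * (G z / f z - principal l z) - (z - c) * (\<Sum>k\<in>{1..M}-{l}. principal k z)
          = (z - c) * E z" for z
      proof -
        have "(\<Sum>k=1..M. principal k z) = principal l z + (\<Sum>k\<in>{1..M}-{l}. principal k z)"
          using l by (intro sum.remove) auto
        then show ?thesis
          by (simp only: E_def right_diff_distrib distrib_left diff_diff_eq)
      qed
      ultimately show ?thesis by simp
    next
      assume "c \<in> poles"
      then obtain j where j: "j \<in> {1..N}" "c = b j" by (elim imageE)
      have "c \<noteq> a l" if "l \<in> {1..M}" for l
        using that \<open>c \<in> poles\<close> disj by force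
      then have "((\<lambda>z. (z - c) * (G z / f z) - (z - c) * (\<Sum>l=1..M. principal l z))
          \<longlongrightarrow> 0 - (c - c) * (\<Sum>l=1..M. principal l c)) (at c)"
        unfolding j(2) by (intro tendsto_intros quotient_at_pole j principal_isCont)
      then show ?thesis by (simp add: E_def ring_distribs)
    qed
    have "((\<lambda>z. principal l z) \<longlongrightarrow> 0) at_infinity" if l: "l \<in> {1..M}" for l
    proof -
      have "m l - 2 < m l - 1" using m_ge[OF l] by simp
      from tendsto_mult_left_zero[OF taylor_poly_quotient_at_infinity[OF this]]
      show ?thesis unfolding principal_def by blast
    qed
    then have "((\<lambda>z. \<Sum>l=1..M. principal l z) \<longlongrightarrow> 0) at_infinity"
      by (intro tendsto_null_sum)
    from tendsto_diff[OF quotient_at_infinity this]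
    show "(E \<longlongrightarrow> 0) at_infinity" by (simp add: E_def)
  qed (use z in auto)
  then show ?thesis by (simp add: E_def principal_def)
qed

end

section \<open>Uniform differentiation with respect to a parameter\<close>

lemma has_vector_derivative_quotient:
  fixes f :: "real \<Rightarrow> complex"
  shows "(f has_vector_derivative D) (at t within T) \<longleftrightarrow>
    ((\<lambda>s. (f s - f t) / of_real (s - t)) \<longlongrightarrow> D) (at t within T)"
proof -
  have "norm ((f s - f t - (s - t) *\<^sub>R D) /\<^sub>R norm (s - t)) = norm ((f s - f t) / of_real (s - t) - D)"
    if "s \<noteq> t" for s
  proof -
    have "(f s - f t) / of_real (s - t) - D = (f s - f t - (s - t) *\<^sub>R D) / of_real (s - t)"
      using that by (simp add: diff_divide_distrib scaleR_conv_of_real del: of_real_diff)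
    show ?thesis
      unfolding \<open>_ = _ / of_real (s - t)\<close> norm_divide norm_scaleR norm_of_real
      by (simp add: divide_inverse mult.commute)
  qed
  then have "\<forall>\<^sub>F s in at t within T. norm ((f s - f t - (s - t) *\<^sub>R D) /\<^sub>R norm (s - t))
      = norm ((f s - f t) / of_real (s - t) - D)"
    by (simp add: eventually_at_filter)
  from tendsto_cong[OF this]
  have "((\<lambda>s. norm ((f s - f t - (s - t) *\<^sub>R D) /\<^sub>R norm (s - t))) \<longlongrightarrow> 0) (at t within T)
      \<longleftrightarrow> ((\<lambda>s. norm ((f s - f t) / of_real (s - t) - D)) \<longlongrightarrow> 0) (at t within T)" .
  then show ?thesis
    unfolding has_vector_derivative_def has_derivative_at_within tendsto_norm_zero_iff LIM_zero_iff
    by (simp only: bounded_linear_scaleR_left simp_thms)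
qed

text \<open>Boundedness of the function and of the derivative is part of the notion, since the
product rule for uniform limits needs it.\<close>
definition has_uniform_derivative :: "complex set \<Rightarrow> real set \<Rightarrow> real \<Rightarrow> (real \<Rightarrow> complex \<Rightarrow> complex) \<Rightarrow>
    (complex \<Rightarrow> complex) \<Rightarrow> bool" where
  "has_uniform_derivative K T t u u' \<longleftrightarrow>
    uniform_limit K (\<lambda>s z. (u s z - u t z) / of_real (s - t)) u' (at t within T) \<and>
    bounded (u t ` K) \<and> bounded (u' ` K)"

lemma has_uniform_derivative_uniform_limit:
  assumes "has_uniform_derivative K T t u u'"
  shows "uniform_limit K u (u t) (at t within T)"
proof -
  have "uniform_limit K (\<lambda>s z. of_real (s - t)) (\<lambda>z. 0 :: complex) (at t within T)"
  proof (rule uniform_limitI)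
    fix e :: real assume "e > 0"
    have "((\<lambda>s. s - t) \<longlongrightarrow> t - t) (at t within T)"
      by (intro tendsto_intros)
    from tendstoD[OF this \<open>e > 0\<close>]
    show "\<forall>\<^sub>F s in at t within T. \<forall>z\<in>K. dist (of_real (s - t)) (0::complex) < e"
      by eventually_elim (simp del: of_real_diff)
  qed
  moreover have "uniform_limit K (\<lambda>s z. (u s z - u t z) / of_real (s - t)) u' (at t within T)"
    "bounded (u' ` K)"
    using assms by (auto simp: has_uniform_derivative_def)
  moreover have "bounded ((\<lambda>z. 0 :: complex) ` K)"
    by (rule bounded_subset[of "{0}"]) auto
  ultimately have "uniform_limit K (\<lambda>s z. of_real (s - t) * ((u s z - u t z) / of_real (s - t)))
      (\<lambda>z. 0 * u' z) (at t within T)"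
    by (intro uniform_lim_mult)
  from uniform_limit_add[OF uniform_limit_const[where S=K and c="u t"] this]
  have *: "uniform_limit K (\<lambda>s z. u t z + of_real (s - t) * ((u s z - u t z) / of_real (s - t)))
      (\<lambda>z. u t z + 0 * u' z) (at t within T)" .
  have "\<forall>\<^sub>F s in at t within T. \<forall>z\<in>K.
      u t z + of_real (s - t) * ((u s z - u t z) / of_real (s - t)) = u s z"
    by (simp add: eventually_at_filter del: of_real_diff)
  from uniform_limit_cong[OF this, of "\<lambda>z. u t z + 0 * u' z" "u t"] * show ?thesis
    by simp
qed

lemma has_uniform_derivative_mult:
  assumes u: "has_uniform_derivative K T t u u'" and v: "has_uniform_derivative K T t v v'"
  shows "has_uniform_derivative K T t (\<lambda>s z. u s z * v s z) (\<lambda>z. u' z * v t z + u t z * v' z)"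
proof -
  have bd: "bounded (u t ` K)" "bounded (u' ` K)" "bounded (v t ` K)" "bounded (v' ` K)"
    using u v by (auto simp: has_uniform_derivative_def)
  have prod_bd: "bounded ((\<lambda>z. f z * g z) ` K)" if fg: "bounded (f ` K)" "bounded (g ` K)"
    for f g :: "complex \<Rightarrow> complex"
  proof -
    obtain A B where "\<forall>x\<in>f ` K. norm x \<le> A" "\<forall>x\<in>g ` K. norm x \<le> B"
      using fg unfolding bounded_iff by (elim exE)
    then have "norm (f z * g z) \<le> A * B" if "z \<in> K" for z
      using that norm_ge_zero[of "f z"] norm_ge_zero[of "g z"]
      by (auto simp: norm_mult intro!: mult_mono order_trans[OF norm_ge_zero])
    then show ?thesis unfolding bounded_iff by (intro exI[of _ "A * B"]) simp
  qed
  have "uniform_limit K (\<lambda>s z. (u s z - u t z) / of_real (s - t) * v s z) (\<lambda>z. u' z * v t z) (at t within T)"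
    using u has_uniform_derivative_uniform_limit[OF v] bd by (intro uniform_lim_mult) (auto simp: has_uniform_derivative_def)
  moreover have "uniform_limit K (\<lambda>s z. u t z * ((v s z - v t z) / of_real (s - t))) (\<lambda>z. u t z * v' z) (at t within T)"
    using v bd by (intro uniform_lim_mult uniform_limit_const) (auto simp: has_uniform_derivative_def)
  ultimately have "uniform_limit K (\<lambda>s z. (u s z - u t z) / of_real (s - t) * v s z
      + u t z * ((v s z - v t z) / of_real (s - t))) (\<lambda>z. u' z * v t z + u t z * v' z) (at t within T)"
    by (rule uniform_limit_add)
  moreover have "(u s z - u t z) / of_real (s - t) * v s z + u t z * ((v s z - v t z) / of_real (s - t))
      = (u s z * v s z - u t z * v t z) / of_real (s - t)" for s z
    by (simp add: diff_divide_distrib ring_distribs del: of_real_diff)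
  ultimately show ?thesis
    unfolding has_uniform_derivative_def using bd by (auto intro!: prod_bd bounded_plus_comp)
qed

lemma has_uniform_derivative_inverse:
  assumes u: "has_uniform_derivative K T t u u'" and c: "c > 0" "\<And>z. z \<in> K \<Longrightarrow> c \<le> norm (u t z)"
  shows "has_uniform_derivative K T t (\<lambda>s z. inverse (u s z)) (\<lambda>z. - u' z * inverse (u t z) * inverse (u t z))"
proof -
  have bd: "bounded (u' ` K)" using u by (simp add: has_uniform_derivative_def)
  have ibd: "norm (inverse (u t z)) \<le> 1 / c" if "z \<in> K" for z
    using c(2)[OF that] c(1) by (simp add: norm_inverse inverse_eq_divide frac_le norm_divide)
  then have ib: "bounded ((\<lambda>z. inverse (u t z)) ` K)"
    unfolding bounded_iff by blast
  obtain B where B: "\<forall>x\<in>u' ` K. norm x \<le> B"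
    using bd unfolding bounded_iff by meson
  have b1: "norm (- u' z * inverse (u t z)) \<le> B * (1/c)" if "z \<in> K" for z
    unfolding norm_mult norm_minus_cancel
    using that B ibd[OF that] order_trans[OF norm_ge_zero[of "u' z"]]
    by (intro mult_mono) auto
  have b2: "norm (- u' z * inverse (u t z) * inverse (u t z)) \<le> (B * (1/c)) * (1/c)" if "z \<in> K" for z
    unfolding norm_mult[of "- u' z * inverse (u t z)"]
    using that b1[OF that] ibd[OF that] order_trans[OF norm_ge_zero b1[OF that]]
    by (intro mult_mono) auto
  have inv: "uniform_limit K (\<lambda>s z. inverse (u s z)) (\<lambda>z. inverse (u t z)) (at t within T)"
    using uniform_lim_inverse[OF has_uniform_derivative_uniform_limit[OF u] c(2,1)] by (simp add: o_def)
  have neg: "uniform_limit K (\<lambda>s z. - ((u s z - u t z) / of_real (s - t))) (\<lambda>z. - u' z) (at t within T)"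
    using u unfolding has_uniform_derivative_def by (intro uniform_limit_uminus) simp
  have "bounded ((\<lambda>z. - u' z) ` K)" using B unfolding bounded_iff by auto
  moreover have "bounded ((\<lambda>z. - u' z * inverse (u t z)) ` K)" using b1 unfolding bounded_iff by blast
  ultimately have *: "uniform_limit K
      (\<lambda>s z. - ((u s z - u t z) / of_real (s - t)) * inverse (u s z) * inverse (u t z))
      (\<lambda>z. - u' z * inverse (u t z) * inverse (u t z)) (at t within T)"
    by (intro uniform_lim_mult neg inv uniform_limit_const ib)
  have "\<forall>\<^sub>F s in at t within T. \<forall>z\<in>K. dist (u s z) (u t z) < c"
    by (rule uniform_limitD[OF has_uniform_derivative_uniform_limit[OF u] c(1)])
  then have ev: "\<forall>\<^sub>F s in at t within T. \<forall>z\<in>K.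
      - ((u s z - u t z) / of_real (s - t)) * inverse (u s z) * inverse (u t z)
      = (inverse (u s z) - inverse (u t z)) / of_real (s - t)"
  proof eventually_elim
    fix s assume s: "\<forall>z\<in>K. dist (u s z) (u t z) < c"
    show "\<forall>z\<in>K. - ((u s z - u t z) / of_real (s - t)) * inverse (u s z) * inverse (u t z)
      = (inverse (u s z) - inverse (u t z)) / of_real (s - t)"
    proof
      fix z assume z: "z \<in> K"
      have "u s z \<noteq> 0"
        using s z c(2)[OF z] by (auto simp: dist_norm)
      moreover have "u t z \<noteq> 0" using c(1) c(2)[OF z] by auto
      ultimately have "inverse (u s z) - inverse (u t z) = - (u s z - u t z) * inverse (u s z) * inverse (u t z)"
        by (simp add: field_simps)
      then show "- ((u s z - u t z) / of_real (s - t)) * inverse (u s z) * inverse (u t z)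
        = (inverse (u s z) - inverse (u t z)) / of_real (s - t)"
        by (simp only: minus_divide_left times_divide_eq_left)
    qed
  qed
  have "uniform_limit K (\<lambda>s z. (inverse (u s z) - inverse (u t z)) / of_real (s - t))
      (\<lambda>z. - u' z * inverse (u t z) * inverse (u t z)) (at t within T)"
    using * uniform_limit_cong[OF ev refl] by blast
  moreover have "bounded ((\<lambda>z. - u' z * inverse (u t z) * inverse (u t z)) ` K)"
    using b2 unfolding bounded_iff by blast
  ultimately show ?thesis
    unfolding has_uniform_derivative_def using ib by simp
qed

text \<open>Only existence is recorded: the derivative is identified afterwards by its pointwise
values.\<close>
lemma has_uniform_derivative_prod:
  assumes "finite I" "\<And>i. i \<in> I \<Longrightarrow> \<exists>u'. has_uniform_derivative K T t (u i) u'"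
  shows "\<exists>w'. has_uniform_derivative K T t (\<lambda>s z. \<Prod>i\<in>I. u i s z) w'"
  using assms
proof (induction I rule: finite_induct)
  case empty
  have "has_uniform_derivative K T t (\<lambda>s z. 1) (\<lambda>z. 0)"
    unfolding has_uniform_derivative_def
    by (auto simp: uniform_limit_const intro: bounded_subset[of "{1}"] bounded_subset[of "{0}"])
  then show ?case by auto
next
  case (insert i I)
  then obtain u' w' where "has_uniform_derivative K T t (u i) u'" "has_uniform_derivative K T t (\<lambda>s z. \<Prod>i\<in>I. u i s z) w'"
    by blast
  from has_uniform_derivative_mult[OF this] show ?case
    using insert.hyps by auto
qed

lemma has_uniform_derivative_shift_power:
  assumes c: "(c has_vector_derivative c') (at t within T)" and K: "bounded K"
  shows "\<exists>u'. has_uniform_derivative K T t (\<lambda>s z. (z - c s) ^ k) u'"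
proof -
  have "has_uniform_derivative K T t (\<lambda>s z. z - c s) (\<lambda>z. - c')"
    unfolding has_uniform_derivative_def
  proof (intro conjI)
    have lim: "((\<lambda>s. (c s - c t) / of_real (s - t)) \<longlongrightarrow> c') (at t within T)"
      using c by (simp only: has_vector_derivative_quotient)
    have eq: "dist ((z - c s - (z - c t)) / of_real (s - t)) (- c') = dist ((c s - c t) / of_real (s - t)) c'" for s z
    proof -
      have "(z - c s - (z - c t)) / of_real (s - t) = - ((c s - c t) / of_real (s - t))"
        by (simp add: diff_divide_distrib del: of_real_diff)
      then show ?thesis by (simp add: dist_norm norm_minus_commute)
    qed
    show "uniform_limit K (\<lambda>s z. (z - c s - (z - c t)) / of_real (s - t)) (\<lambda>z. - c') (at t within T)"
    proof (rule uniform_limitI)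
      fix e :: real assume "e > 0"
      from tendstoD[OF lim this]
      show "\<forall>\<^sub>F s in at t within T. \<forall>z\<in>K. dist ((z - c s - (z - c t)) / of_real (s - t)) (- c') < e"
        by eventually_elim (simp only: eq simp_thms ball_simps ball_triv)
    qed
    show "bounded ((\<lambda>z. z - c t) ` K)" 
      using bounded_translation[OF K, of "- c t"] by simp
    show "bounded ((\<lambda>z. - c') ` K)" by (rule bounded_subset[of "{- c'}"]) auto
  qed
  then have "\<exists>w'. has_uniform_derivative K T t (\<lambda>s z. \<Prod>i\<in>{..<k}. z - c s) w'"
    by (intro has_uniform_derivative_prod) auto
  then show ?thesis by simp
qed

lemma ratio_prod_has_uniform_derivative:
  assumes a: "\<And>l. l \<in> {1..M} \<Longrightarrow> ((\<lambda>s. a s l) has_vector_derivative a' l) (at t within T)"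
    and b: "\<And>j. j \<in> {1..N} \<Longrightarrow> ((\<lambda>s. b s j) has_vector_derivative b' j) (at t within T)"
    and K: "compact K" "K \<inter> b t ` {1..N} = {}"
  shows "\<exists>u'. has_uniform_derivative K T t (\<lambda>s. ratio_prod M N m n (a s) (b s)) u'"
proof -
  have "\<exists>u'. has_uniform_derivative K T t (\<lambda>s z. \<Prod>l=1..M. (z - a s l) ^ (m l - 1)) u'"
    by (rule has_uniform_derivative_prod) (auto intro!: has_uniform_derivative_shift_power a compact_imp_bounded K)
  then obtain u' where u: "has_uniform_derivative K T t (\<lambda>s z. \<Prod>l=1..M. (z - a s l) ^ (m l - 1)) u'" by blast
  have "\<exists>u'. has_uniform_derivative K T t (\<lambda>s z. \<Prod>j=1..N. (z - b s j) ^ (n j + 1)) u'"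
    by (rule has_uniform_derivative_prod) (auto intro!: has_uniform_derivative_shift_power b compact_imp_bounded K simp del: power_Suc)
  then obtain v' where v: "has_uniform_derivative K T t (\<lambda>s z. \<Prod>j=1..N. (z - b s j) ^ (n j + 1)) v'" by blast
  define D where "D = (\<lambda>z. \<Prod>j=1..N. (z - b t j) ^ (n j + 1))"
  have D0: "D z \<noteq> 0" if "z \<in> K" for z
    unfolding D_def using that K(2) by (subst prod_zero_iff) auto
  have "continuous_on K (\<lambda>z. inverse (D z))"
    using D0 unfolding D_def by (intro continuous_intros) auto
  then have "bounded ((\<lambda>z. inverse (D z)) ` K)"
    using K by (intro compact_imp_bounded compact_continuous_image)
  then obtain B where B: "B > 0" "\<And>z. z \<in> K \<Longrightarrow> norm (inverse (D z)) \<le> B"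
    unfolding bounded_pos by auto
  have "inverse B \<le> norm (D z)" if "z \<in> K" for z
  proof -
    have "norm (D z) > 0" using D0[OF that] by simp
    then show ?thesis using B(1) B(2)[OF that] by (simp add: norm_inverse norm_divide field_simps)
  qed
  then have "\<exists>w'. has_uniform_derivative K T t (\<lambda>s z. inverse (\<Prod>j=1..N. (z - b s j) ^ (n j + 1))) w'"
    using has_uniform_derivative_inverse[OF v, of "inverse B"] B(1) unfolding D_def by auto
  then obtain w' where w: "has_uniform_derivative K T t (\<lambda>s z. inverse (\<Prod>j=1..N. (z - b s j) ^ (n j + 1))) w'" by blast
  from has_uniform_derivative_mult[OF u w] show ?thesis
    unfolding ratio_prod_def divide_inverse by blast
qed

section \<open>The logarithmic derivative in the parameter\<close>

text \<open>Writing derivatives as \<open>u t * p\<close> makes the rule for products additive in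
\<open>p\<close>.\<close>
lemma logarithmic_derivative_mult:
  fixes u v :: "real \<Rightarrow> complex"
  assumes "(u has_vector_derivative u t * p) (at t within T)" "(v has_vector_derivative v t * q) (at t within T)"
  shows "((\<lambda>s. u s * v s) has_vector_derivative (u t * v t) * (p + q)) (at t within T)"
proof -
  have "u t * (v t * q) + (u t * p) * v t = (u t * v t) * (p + q)"
    by (simp add: algebra_simps)
  then show ?thesis
    using has_vector_derivative_mult[OF assms] by simp
qed

lemma logarithmic_derivative_prod:
  fixes u :: "'i \<Rightarrow> real \<Rightarrow> complex"
  assumes "finite I" "\<And>i. i \<in> I \<Longrightarrow> (u i has_vector_derivative u i t * p i) (at t within T)"
  shows "((\<lambda>s. \<Prod>i\<in>I. u i s) has_vector_derivative (\<Prod>i\<in>I. u i t) * (\<Sum>i\<in>I. p i)) (at t within T)"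
  using assms
proof (induction I rule: finite_induct)
  case (insert i I)
  then have "(u i has_vector_derivative u i t * p i) (at t within T)"
    "((\<lambda>s. \<Prod>i\<in>I. u i s) has_vector_derivative (\<Prod>i\<in>I. u i t) * (\<Sum>i\<in>I. p i)) (at t within T)"
    by blast+
  from logarithmic_derivative_mult[OF this] show ?case
    using insert.hyps by simp
qed simp

lemma logarithmic_derivative_shift_power:
  fixes c :: "real \<Rightarrow> complex"
  assumes c: "(c has_vector_derivative c') (at t within T)" and z: "z \<noteq> c t"
  shows "((\<lambda>s. (z - c s) ^ k) has_vector_derivative (z - c t) ^ k * (- (of_nat k * c' / (z - c t)))) (at t within T)"
proof -
  have "((\<lambda>s. z - c s) has_vector_derivative 0 - c') (at t within T)"
    by (intro derivative_intros c)
  moreover have "0 - c' = (z - c t) * (- (c' / (z - c t)))"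
    using z by (simp only: mult_minus_right times_divide_eq_right nonzero_mult_div_cancel_left
        right_minus_eq not_False_eq_True diff_0)
  ultimately have "((\<lambda>s. z - c s) has_vector_derivative (z - c t) * (- (c' / (z - c t)))) (at t within T)"
    by simp
  from logarithmic_derivative_prod[of "{..<k}" "\<lambda>i s. z - c s" t "\<lambda>i. - (c' / (z - c t))", OF _ this]
  show ?thesis by simp
qed

lemma logarithmic_derivative_inverse:
  fixes v :: "real \<Rightarrow> complex"
  assumes v: "(v has_vector_derivative v t * q) (at t within T)" and v0: "v t \<noteq> 0"
  shows "((\<lambda>s. inverse (v s)) has_vector_derivative inverse (v t) * (- q)) (at t within T)"
proof -
  have "(inverse has_field_derivative - (inverse (v t) ^ Suc (Suc 0))) (at (v t))"
    using v0 by (rule DERIV_inverse)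
  from field_vector_diff_chain_within[OF v has_field_derivative_at_within[OF this]]
  have "((inverse \<circ> v) has_vector_derivative v t * q * - (inverse (v t) ^ Suc (Suc 0))) (at t within T)" .
  moreover have "v t * q * - (inverse (v t) ^ Suc (Suc 0)) = inverse (v t) * (- q)"
    using v0 by simp
  ultimately show ?thesis by (simp only: o_def)
qed

lemma ratio_prod_has_vector_derivative:
  assumes a: "\<And>l. l \<in> {1..M} \<Longrightarrow> ((\<lambda>s. a s l) has_vector_derivative a' l) (at t within T)"
    and b: "\<And>j. j \<in> {1..N} \<Longrightarrow> ((\<lambda>s. b s j) has_vector_derivative b' j) (at t within T)"
    and z: "z \<notin> a t ` {1..M}" "z \<notin> b t ` {1..N}"
  shows "((\<lambda>s. ratio_prod M N m n (a s) (b s) z) has_vector_derivative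
      ratio_prod M N m n (a t) (b t) z *
      ((\<Sum>j=1..N. of_nat (n j + 1) * b' j / (z - b t j)) - (\<Sum>l=1..M. of_nat (m l - 1) * a' l / (z - a t l))))
      (at t within T)"
proof -
  have num: "((\<lambda>s. \<Prod>l=1..M. (z - a s l) ^ (m l - 1)) has_vector_derivative
      (\<Prod>l=1..M. (z - a t l) ^ (m l - 1)) * (\<Sum>l=1..M. - (of_nat (m l - 1) * a' l / (z - a t l)))) (at t within T)"
    using z(1) by (intro logarithmic_derivative_prod logarithmic_derivative_shift_power a) auto
  have den: "((\<lambda>s. \<Prod>j=1..N. (z - b s j) ^ (n j + 1)) has_vector_derivative
      (\<Prod>j=1..N. (z - b t j) ^ (n j + 1)) * (\<Sum>j=1..N. - (of_nat (n j + 1) * b' j / (z - b t j)))) (at t within T)"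
    using z(2) by (intro logarithmic_derivative_prod logarithmic_derivative_shift_power b) auto
  have "(\<Prod>j=1..N. (z - b t j) ^ (n j + 1)) \<noteq> 0"
    using z(2) by (subst prod_zero_iff) auto
  from logarithmic_derivative_mult[OF num logarithmic_derivative_inverse[OF den this]]
  show ?thesis
    unfolding ratio_prod_def divide_inverse[symmetric] sum_negf minus_minus
    by (simp only: uminus_add_conv_diff)
qed

section \<open>The normalization of the additive constant\<close>

lemma cofinite_open_connected:
  fixes B :: "complex set"
  assumes "finite B"
  shows "open (- B)" "connected (- B)"
proof -
  show "open (- B)" using assms by (intro open_Compl finite_imp_closed)
  show "connected (- B)"
    by (intro path_connected_imp_connected path_connected_complement_countable)
       (auto simp: assms countable_finite)
qed

text \<open>Path independence is only useful once some path exists; in an open connected set a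
polynomial one does.\<close>
lemma integral_between_primitive:
  assumes S: "open S" "connected S" "w \<in> S" "z \<in> S"
    and P: "\<And>z. z \<in> S \<Longrightarrow> (P has_field_derivative p z) (at z)"
    and int: "integral_between S p w z I"
  shows "I = P z - P w"
proof -
  obtain \<gamma> where \<gamma>: "polynomial_function \<gamma>" "path_image \<gamma> \<subseteq> S" "pathstart \<gamma> = w" "pathfinish \<gamma> = z"
    using connected_open_polynomial_connected[OF S] by blast
  have vp: "valid_path \<gamma>" using \<gamma>(1) by (rule valid_path_polynomial_function)
  have "(p has_contour_integral (P (pathfinish \<gamma>) - P (pathstart \<gamma>))) \<gamma>"
    by (rule contour_integral_primitive[OF has_field_derivative_at_within[OF P] vp \<gamma>(2)])
  moreover have "(p has_contour_integral I) \<gamma>"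
    using int vp \<gamma> unfolding integral_between_def by blast
  ultimately show ?thesis
    using has_contour_integral_unique \<gamma>(3,4) by metis
qed

text \<open>The integral from \<open>w\<close> to \<open>z\<close> is \<open>P z - P w\<close>; if
its limit for \<open>w\<close> to infinity is \<open>P z\<close>, then \<open>P w\<close> tends to
0.\<close>
lemma integral_from_infinity_primitive:
  assumes B: "finite B"
    and P: "\<And>z. z \<in> - B \<Longrightarrow> (P has_field_derivative p z) (at z)"
    and int: "\<And>z. z \<in> - B \<Longrightarrow> integral_from_infinity (- B) p z (P z)"
  shows "(P \<longlongrightarrow> 0) at_infinity"
proof -
  obtain z where z: "z \<in> - B"
    using ex_new_if_finite[OF infinite_UNIV_char_0 B] by auto
  obtain J where J: "\<And>w. w \<in> - B \<Longrightarrow> integral_between (- B) p w z (J w)"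
    and lim: "(J \<longlongrightarrow> P z) at_infinity"
    using int[OF z] unfolding integral_from_infinity_def by blast
  have "((\<lambda>w. P z - J w) \<longlongrightarrow> P z - P z) at_infinity"
    by (intro tendsto_intros lim)
  then have "((\<lambda>w. P z - J w) \<longlongrightarrow> 0) at_infinity" by simp
  then show ?thesis
  proof (rule Lim_transform_eventually)
    show "\<forall>\<^sub>F w in at_infinity. P z - J w = P w"
      using eventually_avoids_finite[OF B]
    proof eventually_elim
      fix w assume "w \<notin> B"
      then have "w \<in> - B" by simp
      from integral_between_primitive[OF cofinite_open_connected[OF B] this z P J[OF this]]
      show "P z - J w = P w" by simp
    qed
  qed
qed

lemma contour_integrable_inverted_circle:
  assumes \<rho>: "0 < \<rho>" and cont: "continuous_on (sphere 0 \<rho>) P"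
  shows "(\<lambda>w. P (inverse w) / w) contour_integrable_on circlepath 0 (1 / \<rho>)"
proof (rule contour_integrable_continuous_circlepath)
  have "continuous_on (sphere 0 (1 / \<rho>)) (\<lambda>w. P (inverse w))"
  proof (rule continuous_on_compose2[OF cont])
    show "continuous_on (sphere 0 (1 / \<rho>)) (inverse :: complex \<Rightarrow> complex)"
      using \<rho> by (intro continuous_intros) auto
    show "inverse ` sphere 0 (1 / \<rho>) \<subseteq> (sphere 0 \<rho> :: complex set)"
      using \<rho> by (auto simp: norm_inverse norm_divide)
  qed
  then have "continuous_on (sphere 0 (1 / \<rho>)) (\<lambda>w. P (inverse w) / w)"
    using \<rho> by (intro continuous_intros) auto
  then show "continuous_on (path_image (circlepath 0 (1 / \<rho>))) (\<lambda>w. P (inverse w) / w)"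
    using \<rho> by simp
qed

lemma null_at_infinity_circle_mean:
  assumes r: "0 < r" "r < \<rho>"
    and der: "\<And>z. norm z > r \<Longrightarrow> (P has_field_derivative p z) (at z)"
    and lim: "(P \<longlongrightarrow> 0) at_infinity"
  shows "((\<lambda>w. P (inverse w) / w) has_contour_integral 0) (circlepath 0 (1 / \<rho>))"
proof -
  have "continuous_on (sphere 0 \<rho>) P"
    using der r by (intro continuous_at_imp_continuous_on ballI DERIV_isCont) auto
  then obtain I where I: "((\<lambda>w. P (inverse w) / w) has_contour_integral I) (circlepath 0 (1 / \<rho>))"
    using contour_integrable_inverted_circle[of \<rho> P] r unfolding contour_integrable_on_def by auto
  have "((\<lambda>z. P z * inverse z) \<longlongrightarrow> 0 * 0) at_infinity"
    by (intro tendsto_intros lim tendsto_inverse_0)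
  then have "((\<lambda>z. P z / z) \<longlongrightarrow> 0) at_infinity"
    by (simp add: divide_inverse)
  from circle_mean_at_infinity[OF r der this I]
  have "(P \<longlongrightarrow> I / (2 * of_real pi * \<i>)) at_infinity" .
  from tendsto_unique[OF trivial_limit_at_infinity this lim] have "I = 0" by simp
  with I show ?thesis by simp
qed

lemma inverse_square_circle_integral:
  assumes "0 < (\<rho>::real)"
  shows "((\<lambda>w. inverse w ^ 2) has_contour_integral 0) (circlepath 0 (1 / \<rho>))"
proof -
  have "((\<lambda>w. inverse w ^ 2) has_contour_integral
      (- inverse (pathfinish (circlepath 0 (1 / \<rho>))) - - inverse (pathstart (circlepath 0 (1 / \<rho>)))))
      (circlepath 0 (1 / \<rho>))"
  proof (rule contour_integral_primitive[where S="- {0}"])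
    fix w :: complex assume "w \<in> - {0}"
    then have "w \<noteq> 0" by simp
    from DERIV_minus[OF DERIV_inverse[OF this, of "- {0}"]]
    show "((\<lambda>w. - inverse w) has_field_derivative inverse w ^ 2) (at w within - {0})"
      by (simp add: numeral_2_eq_2)
  qed (use assms in auto)
  then show ?thesis by simp
qed

context critical_data
begin

text \<open>Otherwise \<open>z f(z)\<close> tends to 1 at infinity, so the integral of
\<open>f\<close> over a large circle is not 0, in spite of the primitive.\<close>
lemma single_valued_degrees:
  assumes F: "\<And>z. z \<notin> poles \<Longrightarrow> (F has_field_derivative f z) (at z)"
    and r: "0 < r" "\<And>z. z \<in> poles \<Longrightarrow> norm z \<le> r"
  shows "total_crit M m + 1 \<noteq> total_pole N n"
proof
  assume eq: "total_crit M m + 1 = total_pole N n"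
  \<comment> \<open>Dividing \<open>h\<close> by the variable in the coordinate \<open>1/z\<close> gives the derivative of \<open>- F (1/w)\<close>.\<close>
  define h where "h = (\<lambda>z. f z * z)"
  have h1: "(h \<longlongrightarrow> 1) at_infinity"
  proof (rule Lim_transform_eventually[OF f_at_infinity])
    show "\<forall>\<^sub>F z in at_infinity. f z * z ^ total_pole N n / z ^ total_crit M m = h z"
      using eventually_not_equal_at_infinity[of 0]
      by eventually_elim (simp add: eq[symmetric] h_def)
  qed
  have hol: "h holomorphic_on - poles"
    unfolding h_def ratio_prod_def by (intro holomorphic_intros) auto
  have np: "z \<notin> poles" if "norm z > r" for z
    using r(2)[of z] that by auto
  have der: "(h has_field_derivative deriv h z) (at z)" if "norm z > r" for z
    using np[OF that] by (intro holomorphic_derivI[OF hol] cofinite_open_connected) auto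
  have "((\<lambda>z. h z * inverse z) \<longlongrightarrow> 1 * 0) at_infinity"
    by (intro tendsto_intros h1 tendsto_inverse_0)
  then have hz: "((\<lambda>z. h z / z) \<longlongrightarrow> 0) at_infinity"
    by (simp add: divide_inverse)
  define C where "C = circlepath 0 (1 / (r + 1))"
  have img: "w \<noteq> 0" "norm (inverse w) > r" if "w \<in> path_image C" for w
    using that r(1) by (auto simp: C_def norm_inverse norm_divide)
  have "((\<lambda>w. h (inverse w) / w) has_contour_integral
      (- F (inverse (pathfinish C)) - - F (inverse (pathstart C)))) C"
  proof (rule contour_integral_primitive[where S="path_image C"])
    fix w assume w: "w \<in> path_image C"
    have "((\<lambda>w. - F (inverse w)) has_field_derivative - (f (inverse w) * - (inverse w ^ Suc (Suc 0)))) (at w)"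
      by (intro DERIV_minus DERIV_chain2[OF F] DERIV_inverse np img w)
    then show "((\<lambda>w. - F (inverse w)) has_field_derivative h (inverse w) / w) (at w within path_image C)"
      by (simp add: h_def divide_inverse mult.assoc has_field_derivative_at_within)
  qed (auto simp: C_def)
  then have "((\<lambda>w. h (inverse w) / w) has_contour_integral 0) (circlepath 0 (1 / (r + 1)))"
    by (simp add: C_def)
  from circle_mean_at_infinity[OF r(1) _ der hz this] have "(h \<longlongrightarrow> 0) at_infinity"
    by simp
  from tendsto_unique[OF trivial_limit_at_infinity this h1] show False by simp
qed

text \<open>For \<open>m = n\<close> the normalized function is \<open>F - z\<close>, but
\<open>z\<close> has mean 0 over the circle as well, so that the resulting condition has the same
form in both cases.\<close>
lemma normalized_circle_mean:
  assumes F: "\<And>z. z \<notin> poles \<Longrightarrow> (F has_field_derivative f z) (at z)"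
    and norm: "additive_normalized M N m n a b F"
    and le: "total_crit M m \<le> total_pole N n"
    and r: "0 < r" "r < \<rho>" "\<And>z. z \<in> poles \<Longrightarrow> norm z \<le> r"
  shows "((\<lambda>w. F (inverse w) / w) has_contour_integral 0) (circlepath 0 (1 / \<rho>))"
proof -
  have np: "z \<notin> poles" if "norm z > r" for z
    using r(3)[of z] that by auto
  have fin: "finite poles" by simp
  show ?thesis
  proof (cases "total_crit M m = total_pole N n")
    case True
    define P where "P = (\<lambda>z. F z - z)"
    have der: "(P has_field_derivative f z - 1) (at z)" if "z \<notin> poles" for z
      unfolding P_def by (intro derivative_intros F that)
    have "(P \<longlongrightarrow> 0) at_infinity"
    proof (rule integral_from_infinity_primitive[OF fin])
      fix z assume z: "z \<in> - poles"
      then show "(P has_field_derivative f z - 1) (at z)" by (intro der) simp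
      show "integral_from_infinity (- poles) (\<lambda>z. f z - 1) z (P z)"
        using norm True z unfolding additive_normalized_def Let_def P_def by blast
    qed
    from null_at_infinity_circle_mean[OF r(1,2) der[OF np] this]
    have "((\<lambda>w. P (inverse w) / w) has_contour_integral 0) (circlepath 0 (1 / \<rho>))" .
    from has_contour_integral_add[OF this inverse_square_circle_integral[of \<rho>]]
    have "((\<lambda>w. P (inverse w) / w + inverse w ^ 2) has_contour_integral 0) (circlepath 0 (1 / \<rho>))"
      using r by simp
    moreover have "P (inverse w) / w + inverse w ^ 2 = F (inverse w) / w" for w
      by (simp add: P_def divide_inverse power2_eq_square left_diff_distrib)
    ultimately show ?thesis by simp
  next
    case False
    then have lt: "total_crit M m + 1 < total_pole N n"
      using le single_valued_degrees[OF F r(1,3)] by linarith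
    have "(F \<longlongrightarrow> 0) at_infinity"
    proof (rule integral_from_infinity_primitive[OF fin])
      fix z assume z: "z \<in> - poles"
      then show "(F has_field_derivative f z) (at z)" by (intro F) simp
      show "integral_from_infinity (- poles) f z (F z)"
        using norm lt z unfolding additive_normalized_def Let_def by blast
    qed
    from null_at_infinity_circle_mean[OF r(1,2) F[OF np] this] show ?thesis .
  qed
qed

lemma normalized_first_critical_value:
  assumes norm: "additive_normalized M N m n a b F"
    and gt: "total_crit M m > total_pole N n"
  shows "1 \<in> {1..M}" "F (a 1) = 0"
proof -
  have "M \<noteq> 0" using gt by (cases M) (auto simp: total_crit_def)
  then show 1: "1 \<in> {1..M}" by simp
  then have a1: "a 1 \<in> - poles" using disj by blast
  then have "integral_between (- poles) f (a 1) (a 1) (F (a 1))"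
    using norm gt unfolding additive_normalized_def Let_def by blast
  then have "(f has_contour_integral F (a 1)) (linepath (a 1) (a 1))"
    unfolding integral_between_def by (elim allE[of _ "linepath (a 1) (a 1)"]) (use a1 in simp)
  then show "F (a 1) = 0" by simp
qed

end

section \<open>Differentiation of the family\<close>

locale critical_family =
  fixes T :: "real set" and t :: real and M N :: nat and m n :: "nat \<Rightarrow> nat"
    and a b :: "real \<Rightarrow> nat \<Rightarrow> complex" and a' b' :: "nat \<Rightarrow> complex"
    and R :: "real \<Rightarrow> complex \<Rightarrow> complex"
  assumes t: "t \<in> T" and nontrivial: "at t within T \<noteq> bot"
    and data: "\<And>s. s \<in> T \<Longrightarrow> critical_data M N m (a s) (b s)"
    and a_deriv: "\<And>l. l \<in> {1..M} \<Longrightarrow> ((\<lambda>s. a s l) has_vector_derivative a' l) (at t within T)"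
    and b_deriv: "\<And>j. j \<in> {1..N} \<Longrightarrow> ((\<lambda>s. b s j) has_vector_derivative b' j) (at t within T)"
    and R_deriv: "\<And>s z. s \<in> T \<Longrightarrow> z \<notin> b s ` {1..N} \<Longrightarrow>
      (R s has_field_derivative ratio_prod M N m n (a s) (b s) z) (at z)"
    and normalized: "\<And>s. s \<in> T \<Longrightarrow> additive_normalized M N m n (a s) (b s) (R s)"
    and centered_deriv: "(\<Sum>l=1..M. of_nat (m l - 1) * a' l) = (\<Sum>j=1..N. of_nat (n j + 1) * b' j)"
begin

abbreviation F :: "real filter" where "F \<equiv> at t within T"
abbreviation B :: "real \<Rightarrow> complex set" where "B s \<equiv> b s ` {1..N}"
abbreviation f :: "real \<Rightarrow> complex \<Rightarrow> complex" where "f s \<equiv> ratio_prod M N m n (a s) (b s)"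

text \<open>Difference quotients in the parameter; \<open>q s\<close> is the derivative of \<open>Q
s\<close> in \<open>z\<close>.\<close>
definition Q :: "real \<Rightarrow> complex \<Rightarrow> complex" where "Q s z = (R s z - R t z) / of_real (s - t)"
definition q :: "real \<Rightarrow> complex \<Rightarrow> complex" where "q s z = (f s z - f t z) / of_real (s - t)"
definition f_dot :: "complex \<Rightarrow> complex" where "f_dot z = vector_derivative (\<lambda>s. f s z) F"

lemma eventually_in_T: "\<forall>\<^sub>F s in F. s \<in> T \<and> s \<noteq> t"
  by (simp add: eventually_at_filter)

lemma eventually_avoids_poles:
  assumes "closed K" "K \<inter> B t = {}"
  shows "\<forall>\<^sub>F s in F. K \<inter> B s = {}"
proof -
  have "\<forall>\<^sub>F s in F. b s j \<in> - K" if "j \<in> {1..N}" for j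
  proof (rule topological_tendstoD)
    show "((\<lambda>s. b s j) \<longlongrightarrow> b t j) F"
      using has_vector_derivative_continuous[OF b_deriv[OF that]] by (simp add: continuous_within)
    show "open (- K)" "b t j \<in> - K" using assms that by auto
  qed
  then have "\<forall>\<^sub>F s in F. \<forall>j\<in>{1..N}. b s j \<in> - K"
    by (intro eventually_ball_finite) auto
  then show ?thesis by eventually_elim auto
qed

text \<open>The derivatives on different sets \<open>K\<close> agree, as pointwise they are
derivatives of \<open>s \<mapsto> f s z\<close> and \<open>t\<close> is a limit point of
\<open>T\<close>.\<close>
lemma f_uniform_derivative:
  assumes K: "compact K" "K \<inter> B t = {}"
  shows "has_uniform_derivative K T t f f_dot"
proof -
  obtain u' where u: "has_uniform_derivative K T t f u'"
    using ratio_prod_has_uniform_derivative[where a=a and b=b and M=M and N=N and m=m and n=n, OF a_deriv b_deriv K]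
    by blast
  have "u' z = f_dot z" if "z \<in> K" for z
  proof -
    have "((\<lambda>s. (f s z - f t z) / of_real (s - t)) \<longlongrightarrow> u' z) F"
      using u that unfolding has_uniform_derivative_def by (intro tendsto_uniform_limitI) auto
    then have "((\<lambda>s. f s z) has_vector_derivative u' z) F"
      by (simp only: has_vector_derivative_quotient)
    then show ?thesis
      unfolding f_dot_def using nontrivial by (intro vector_derivative_within[symmetric])
  qed
  then have "uniform_limit K (\<lambda>s z. (f s z - f t z) / of_real (s - t)) u' F
      \<longleftrightarrow> uniform_limit K (\<lambda>s z. (f s z - f t z) / of_real (s - t)) f_dot F"
    and "u' ` K = f_dot ` K"
    by (auto intro!: uniform_limit_cong')
  then show ?thesis using u unfolding has_uniform_derivative_def by simp
qed

lemma q_uniform_limit: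
  assumes "compact K" "K \<inter> B t = {}"
  shows "uniform_limit K q f_dot F"
  using f_uniform_derivative[OF assms] unfolding has_uniform_derivative_def q_def by blast

lemma f_dot_eq:
  assumes "z \<notin> a t ` {1..M}" "z \<notin> B t"
  shows "f_dot z = f t z * ((\<Sum>j=1..N. of_nat (n j + 1) * b' j / (z - b t j))
      - (\<Sum>l=1..M. of_nat (m l - 1) * a' l / (z - a t l)))"
  unfolding f_dot_def
  by (rule vector_derivative_within[OF nontrivial ratio_prod_has_vector_derivative[where a=a and b=b, OF a_deriv b_deriv assms]])

lemma Q_deriv:
  assumes "s \<in> T" "z \<notin> B s" "z \<notin> B t"
  shows "(Q s has_field_derivative q s z) (at z)"
  unfolding Q_def q_def by (intro DERIV_cdivide DERIV_diff R_deriv assms t)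

lemma f_continuous: "continuous_on (- B s) (f s)"
  unfolding ratio_prod_def by (intro continuous_intros) auto

lemma q_continuous: "K \<inter> B s = {} \<Longrightarrow> K \<inter> B t = {} \<Longrightarrow> continuous_on K (q s)"
  unfolding q_def divide_inverse
  by (intro continuous_intros continuous_on_subset[OF f_continuous]) auto

lemma cball_avoiding_poles:
  assumes "z \<notin> B t"
  obtains d where "d > 0" "cball z d \<inter> B t = {}"
proof -
  have "open (- B t)" "z \<in> - B t"
    using assms cofinite_open_connected(1)[of "B t"] by auto
  then obtain d where "d > 0" "cball z d \<subseteq> - B t"
    using open_contains_cball by blast
  then show ?thesis by (intro that[of d]) auto
qed

text \<open>The increment of \<open>Q s\<close> is the integral of \<open>q s\<close>, and
integration over a segment respects uniform limits.\<close>
lemma increment_tendsto: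
  assumes K: "cball x d \<inter> B t = {}" and yz: "y \<in> cball x d" "z \<in> cball x d"
  shows "f_dot contour_integrable_on linepath y z"
    and "((\<lambda>s. Q s z - Q s y) \<longlongrightarrow> contour_integral (linepath y z) f_dot) F"
proof -
  have seg: "path_image (linepath y z) \<subseteq> cball x d"
    using yz by (simp add: closed_segment_subset)
  have ev: "\<forall>\<^sub>F s in F. (q s has_contour_integral (Q s z - Q s y)) (linepath y z)"
    using eventually_in_T eventually_avoids_poles[OF closed_cball K]
  proof eventually_elim
    fix s assume s: "s \<in> T \<and> s \<noteq> t" "cball x d \<inter> B s = {}"
    have "(q s has_contour_integral (Q s (pathfinish (linepath y z)) - Q s (pathstart (linepath y z)))) (linepath y z)"
    proof (rule contour_integral_primitive[where S="cball x d"])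
      fix w assume "w \<in> cball x d"
      then show "(Q s has_field_derivative q s w) (at w within cball x d)"
        using s K by (intro has_field_derivative_at_within[OF Q_deriv]) auto
    qed (use seg in auto)
    then show "(q s has_contour_integral (Q s z - Q s y)) (linepath y z)" by simp
  qed
  have int: "\<forall>\<^sub>F s in F. q s contour_integrable_on linepath y z"
    using ev by eventually_elim (auto simp: contour_integrable_on_def)
  have ul: "uniform_limit (path_image (linepath y z)) q f_dot F"
    by (rule uniform_limit_on_subset[OF q_uniform_limit[OF compact_cball K] seg])
  have bd: "norm (vector_derivative (linepath y z) (at u)) \<le> norm (z - y)" for u
    by (simp add: vector_derivative_linepath_at)
  show "f_dot contour_integrable_on linepath y z"
    by (rule contour_integral_uniform_limit(1)[OF int ul bd _ nontrivial]) simp_all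
  have "((\<lambda>s. contour_integral (linepath y z) (q s)) \<longlongrightarrow> contour_integral (linepath y z) f_dot) F"
    by (rule contour_integral_uniform_limit(2)[OF int ul bd _ nontrivial]) simp_all
  then show "((\<lambda>s. Q s z - Q s y) \<longlongrightarrow> contour_integral (linepath y z) f_dot) F"
  proof (rule Lim_transform_eventually)
    show "\<forall>\<^sub>F s in F. contour_integral (linepath y z) (q s) = Q s z - Q s y"
      using ev by eventually_elim (rule contour_integral_unique)
  qed
qed

text \<open>Convergence of increments is an equivalence relation on points; its classes are open
since segments in a disc off the poles give convergence, and the complement of the poles is
connected.\<close>
lemma increments_converge:
  assumes "y \<notin> B t" "z \<notin> B t"
  shows "\<exists>l. ((\<lambda>s. Q s z - Q s y) \<longlongrightarrow> l) F"
proof (rule connected_equivalence_relation[where S="- B t"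
      and R="\<lambda>y z. \<exists>l. ((\<lambda>s. Q s z - Q s y) \<longlongrightarrow> l) F"])
  show "connected (- B t)" by (intro cofinite_open_connected) simp
  show "\<exists>l. ((\<lambda>s. Q s x - Q s y) \<longlongrightarrow> l) F" if "\<exists>l. ((\<lambda>s. Q s y - Q s x) \<longlongrightarrow> l) F" for x y
  proof -
    from that obtain l where "((\<lambda>s. Q s y - Q s x) \<longlongrightarrow> l) F" by blast
    from tendsto_minus[OF this] show ?thesis by (intro exI[of _ "- l"]) simp
  qed
  show "\<exists>l. ((\<lambda>s. Q s z - Q s x) \<longlongrightarrow> l) F"
    if "\<exists>l. ((\<lambda>s. Q s y - Q s x) \<longlongrightarrow> l) F" "\<exists>l. ((\<lambda>s. Q s z - Q s y) \<longlongrightarrow> l) F" for x y z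
  proof -
    from that obtain k l where "((\<lambda>s. Q s y - Q s x) \<longlongrightarrow> k) F" "((\<lambda>s. Q s z - Q s y) \<longlongrightarrow> l) F"
      by blast
    from tendsto_add[OF this] show ?thesis by (intro exI[of _ "k + l"]) simp
  qed
  show "\<exists>U. openin (top_of_set (- B t)) U \<and> x \<in> U \<and>
      (\<forall>z\<in>U. \<exists>l. ((\<lambda>s. Q s z - Q s x) \<longlongrightarrow> l) F)" if "x \<in> - B t" for x
  proof -
    from that have "x \<notin> B t" by simp
    then obtain d where d: "d > 0" "cball x d \<inter> B t = {}" by (rule cball_avoiding_poles)
    show ?thesis
    proof (intro exI[of _ "ball x d"] conjI ballI)
      have "ball x d \<subseteq> - B t" using d(2) ball_subset_cball by blast
      then show "openin (top_of_set (- B t)) (ball x d)"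
        by (intro open_subset) auto
      fix z assume "z \<in> ball x d"
      then show "\<exists>l. ((\<lambda>s. Q s z - Q s x) \<longlongrightarrow> l) F"
        using d increment_tendsto(2)[OF d(2), of x z] by (intro exI) auto
    qed (use d in auto)
  qed
qed (use assms in auto)

text \<open>The shift \<open>c\<close> is either 0 or the value of \<open>Q s\<close> at a base
point. The second choice is needed before the convergence of \<open>Q\<close> itself is
known.\<close>
lemma limit_deriv:
  assumes P: "\<And>z. z \<notin> B t \<Longrightarrow> ((\<lambda>s. Q s z - c s) \<longlongrightarrow> P z) F" and z: "z \<notin> B t"
  shows "(P has_field_derivative f_dot z) (at z)"
proof -
  obtain d where d: "d > 0" "cball z d \<inter> B t = {}" using z by (rule cball_avoiding_poles)
  have incr: "contour_integral (linepath x y) f_dot = P y - P x" if "x \<in> cball z d" "y \<in> cball z d" for x y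
  proof -
    have "((\<lambda>s. (Q s y - c s) - (Q s x - c s)) \<longlongrightarrow> P y - P x) F"
      using that d(2) by (intro tendsto_diff P) auto
    then have "((\<lambda>s. Q s y - Q s x) \<longlongrightarrow> P y - P x) F" by simp
    from tendsto_unique[OF nontrivial increment_tendsto(2)[OF d(2) that] this] show ?thesis .
  qed
  have "\<forall>\<^sub>F s in F. continuous_on (cball z d) (q s)"
    using eventually_avoids_poles[OF closed_cball d(2)] by eventually_elim (rule q_continuous[OF _ d(2)])
  from uniform_limit_theorem[OF this q_uniform_limit[OF compact_cball d(2)] nontrivial]
  have cont: "continuous_on (cball z d) f_dot" .
  have "((\<lambda>x. contour_integral (linepath z x) f_dot) has_field_derivative f_dot z) (at z within cball z d)"
    using d(1) incr
    by (intro triangle_contour_integrals_convex_primitive[OF cont]) auto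
  then have "((\<lambda>x. contour_integral (linepath z x) f_dot) has_field_derivative f_dot z) (at z)"
    using at_within_interior[of z "cball z d"] d(1) by simp
  then have "((\<lambda>x. P x - P z) has_field_derivative f_dot z) (at z)"
  proof (rule has_field_derivative_transform_within_open[of _ _ _ "ball z d"])
    show "contour_integral (linepath z x) f_dot = P x - P z" if "x \<in> ball z d" for x
      using that d(1) by (intro incr) auto
  qed (use d in auto)
  from DERIV_add[OF this DERIV_const[of "P z"]] show ?thesis by simp
qed

text \<open>On a disc the mean value inequality transfers the uniform convergence of the
derivatives; a compact set is covered by finitely many discs.\<close>
lemma limit_uniform:
  assumes P: "\<And>z. z \<notin> B t \<Longrightarrow> ((\<lambda>s. Q s z - c s) \<longlongrightarrow> P z) F"
    and K: "compact K" "K \<inter> B t = {}"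
  shows "uniform_limit K (\<lambda>s z. Q s z - c s) P F"
proof -
  have local: "uniform_limit (cball x d) (\<lambda>s z. Q s z - c s) P F"
    if d: "d > 0" "cball x d \<inter> B t = {}" for x d
  proof (rule uniform_limitI)
    fix e :: real assume e: "e > 0"
    have "x \<in> cball x d" using d(1) by simp
    then have x: "x \<notin> B t" using d(2) by blast
    define \<eta> where "\<eta> = e / (2 * d)"
    have \<eta>: "\<eta> > 0" "\<eta> * d = e / 2" using e d by (auto simp: \<eta>_def)
    from tendstoD[OF P[OF x], of "e/2"] e have "\<forall>\<^sub>F s in F. dist (Q s x - c s) (P x) < e/2" by simp
    moreover have "\<forall>\<^sub>F s in F. \<forall>z\<in>cball x d. dist (q s z) (f_dot z) < \<eta>"
      by (rule uniform_limitD[OF q_uniform_limit[OF compact_cball d(2)] \<eta>(1)])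
    ultimately show "\<forall>\<^sub>F s in F. \<forall>z\<in>cball x d. dist (Q s z - c s) (P z) < e"
      using eventually_in_T eventually_avoids_poles[OF closed_cball d(2)]
    proof eventually_elim
      fix s assume s: "dist (Q s x - c s) (P x) < e/2" "\<forall>z\<in>cball x d. dist (q s z) (f_dot z) < \<eta>"
        "s \<in> T \<and> s \<noteq> t" "cball x d \<inter> B s = {}"
      show "\<forall>z\<in>cball x d. dist (Q s z - c s) (P z) < e"
      proof
        fix z assume z: "z \<in> cball x d"
        have "norm ((Q s z - P z) - (Q s x - P x)) \<le> \<eta> * norm (z - x)"
        proof (rule field_differentiable_bound[where S="cball x d" and f="\<lambda>z. Q s z - P z"
              and f'="\<lambda>z. q s z - f_dot z"])
          fix w assume w: "w \<in> cball x d"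
          then have "w \<notin> B s" "w \<notin> B t" using s(4) d(2) by blast+
          then show "((\<lambda>z. Q s z - P z) has_field_derivative q s w - f_dot w) (at w within cball x d)"
            using s(3) by (intro has_field_derivative_at_within[OF DERIV_diff] Q_deriv limit_deriv[OF P]) auto
          show "norm (q s w - f_dot w) \<le> \<eta>" using s(2) w by (simp add: dist_norm[symmetric] less_imp_le del: mem_cball)
        qed (use z d in auto)
        also have "\<dots> \<le> \<eta> * d"
          using z \<eta> by (intro mult_left_mono) (auto simp: dist_norm norm_minus_commute)
        finally have "norm ((Q s z - P z) - (Q s x - P x)) \<le> e / 2" using \<eta> by simp
        moreover have "norm (Q s x - c s - P x) < e / 2" using s(1) by (simp add: dist_norm)
        moreover have "Q s z - c s - P z = ((Q s z - P z) - (Q s x - P x)) + (Q s x - c s - P x)" by simp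
        ultimately have "norm (Q s z - c s - P z) < e"
          using norm_triangle_ineq[of "(Q s z - P z) - (Q s x - P x)" "Q s x - c s - P x"]
          by (simp only:)
        then show "dist (Q s z - c s) (P z) < e" by (simp add: dist_norm)
      qed
    qed
  qed
  have "\<exists>d. d > 0 \<and> cball x d \<inter> B t = {}" if "x \<in> K" for x
  proof -
    have "x \<notin> B t" using that K(2) by blast
    then show ?thesis using cball_avoiding_poles by metis
  qed
  then obtain d where d: "\<And>x. x \<in> K \<Longrightarrow> d x > 0" "\<And>x. x \<in> K \<Longrightarrow> cball x (d x) \<inter> B t = {}"
    by metis
  have "K \<subseteq> (\<Union>x\<in>K. ball x (d x))" using d(1) by auto
  from compactE_image[OF K(1) _ this]
  obtain C where C: "C \<subseteq> K" "finite C" "K \<subseteq> (\<Union>x\<in>C. ball x (d x))" by auto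
  have "uniform_limit (\<Union>x\<in>C. cball x (d x)) (\<lambda>s z. Q s z - c s) P F"
  proof (rule uniform_limit_on_UNION[OF C(2)])
    fix x assume "x \<in> C"
    then have "x \<in> K" using C(1) by blast
    then show "uniform_limit (cball x (d x)) (\<lambda>s z. Q s z - c s) P F"
      by (intro local d)
  qed
  moreover have "K \<subseteq> (\<Union>x\<in>C. cball x (d x))"
    by (rule order_trans[OF C(3) UN_mono[OF order_refl ball_subset_cball]])
  ultimately show ?thesis by (rule uniform_limit_on_subset)
qed

lemma circle_mean_limit:
  assumes P: "\<And>z. z \<notin> B t \<Longrightarrow> ((\<lambda>s. Q s z - c s) \<longlongrightarrow> P z) F"
    and \<rho>: "0 < \<rho>" "sphere 0 \<rho> \<inter> B t = {}"
  shows "(\<lambda>w. P (inverse w) / w) contour_integrable_on circlepath 0 (1 / \<rho>)"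
    and "((\<lambda>s. contour_integral (circlepath 0 (1 / \<rho>)) (\<lambda>w. (Q s (inverse w) - c s) / w))
      \<longlongrightarrow> contour_integral (circlepath 0 (1 / \<rho>)) (\<lambda>w. P (inverse w) / w)) F"
proof -
  have int: "\<forall>\<^sub>F s in F. (\<lambda>w. (Q s (inverse w) - c s) / w) contour_integrable_on circlepath 0 (1 / \<rho>)"
    using eventually_in_T eventually_avoids_poles[OF closed_sphere \<rho>(2)]
  proof eventually_elim
    fix s assume s: "s \<in> T \<and> s \<noteq> t" "sphere 0 \<rho> \<inter> B s = {}"
    have "continuous_on (sphere 0 \<rho>) (\<lambda>z. Q s z - c s)"
    proof (intro continuous_intros continuous_at_imp_continuous_on ballI DERIV_isCont)
      fix z :: complex assume "z \<in> sphere 0 \<rho>"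
      then show "(Q s has_field_derivative q s z) (at z)" using s \<rho> by (intro Q_deriv) auto
    qed
    from contour_integrable_inverted_circle[OF \<rho>(1) this]
    show "(\<lambda>w. (Q s (inverse w) - c s) / w) contour_integrable_on circlepath 0 (1 / \<rho>)" .
  qed
  have img: "norm w = 1 / \<rho>" "inverse w \<in> sphere 0 \<rho>" if "w \<in> path_image (circlepath 0 (1 / \<rho>))" for w
    using that \<rho> by (auto simp: norm_inverse norm_divide)
  have ul: "uniform_limit (path_image (circlepath 0 (1 / \<rho>))) (\<lambda>s w. (Q s (inverse w) - c s) / w)
      (\<lambda>w. P (inverse w) / w) F"
  proof (rule uniform_limitI)
    fix e :: real assume "e > 0"
    then have "e / \<rho> > 0" using \<rho> by simp
    moreover have "uniform_limit (sphere 0 \<rho>) (\<lambda>s z. Q s z - c s) P F"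
      by (intro limit_uniform P compact_sphere \<rho>)
    ultimately have "\<forall>\<^sub>F s in F. \<forall>z\<in>sphere 0 \<rho>. dist (Q s z - c s) (P z) < e / \<rho>"
      by (rule uniform_limitD[rotated])
    then
    show "\<forall>\<^sub>F s in F. \<forall>w\<in>path_image (circlepath 0 (1 / \<rho>)).
        dist ((Q s (inverse w) - c s) / w) (P (inverse w) / w) < e"
    proof eventually_elim
      fix s assume s: "\<forall>z\<in>sphere 0 \<rho>. dist (Q s z - c s) (P z) < e / \<rho>"
      show "\<forall>w\<in>path_image (circlepath 0 (1 / \<rho>)).
        dist ((Q s (inverse w) - c s) / w) (P (inverse w) / w) < e"
      proof
        fix w assume w: "w \<in> path_image (circlepath 0 (1 / \<rho>))"
        have "dist ((Q s (inverse w) - c s) / w) (P (inverse w) / w)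
            = norm (Q s (inverse w) - c s - P (inverse w)) / norm w"
          by (simp only: dist_norm norm_divide diff_divide_distrib[symmetric])
        also have "\<dots> = norm (Q s (inverse w) - c s - P (inverse w)) * \<rho>"
          using img(1)[OF w] by simp
        also have "\<dots> < (e / \<rho>) * \<rho>"
          using s img(2)[OF w] \<rho>(1)
          by (intro mult_strict_right_mono) (simp_all add: dist_norm[symmetric] del: mem_sphere)
        finally show "dist ((Q s (inverse w) - c s) / w) (P (inverse w) / w) < e"
          using \<rho>(1) by simp
      qed
    qed
  qed
  have bd: "norm (vector_derivative (circlepath 0 (1 / \<rho>)) (at u)) \<le> 2 * pi * (1 / \<rho>)" for u
    using \<rho>(1) by (simp add: vector_derivative_circlepath norm_mult norm_divide)
  show "(\<lambda>w. P (inverse w) / w) contour_integrable_on circlepath 0 (1 / \<rho>)"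
    by (rule contour_integral_uniform_limit(1)[OF int ul bd _ nontrivial]) simp_all
  show "((\<lambda>s. contour_integral (circlepath 0 (1 / \<rho>)) (\<lambda>w. (Q s (inverse w) - c s) / w))
      \<longlongrightarrow> contour_integral (circlepath 0 (1 / \<rho>)) (\<lambda>w. P (inverse w) / w)) F"
    by (rule contour_integral_uniform_limit(2)[OF int ul bd _ nontrivial]) simp_all
qed

text \<open>Moving the argument from \<open>a t l\<close> to \<open>a s l\<close>, a distance of
order \<open>s - t\<close>, changes \<open>R s\<close> by \<open>o(s - t)\<close>, because its
derivative \<open>f s\<close> is uniformly small there: it vanishes at \<open>a t l\<close> for
\<open>s = t\<close>.\<close>
lemma critical_value_shift:
  assumes l: "l \<in> {1..M}"
  shows "((\<lambda>s. (R s (a s l) - R s (a t l)) / of_real (s - t)) \<longlongrightarrow> 0) F"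
proof (rule tendstoI)
  fix e :: real assume e: "e > 0"
  note disj = critical_data.disj[OF data[OF t]] and m_ge = critical_data.m_ge[OF data[OF t]]
  \<comment> \<open>A strict bound for the difference quotients of \<open>a l\<close> near \<open>t\<close>.\<close>
  define c where "c = norm (a' l) + 1"
  have c: "c > 0" unfolding c_def by (intro add_nonneg_pos) auto
  have a_notin: "a t l \<notin> B t" using l disj by blast
  obtain d where d: "d > 0" "cball (a t l) d \<inter> B t = {}" using a_notin by (rule cball_avoiding_poles)
  have "m l - 1 > 0" using m_ge[OF l] by simp
  then have f0: "f t (a t l) = 0"
    unfolding ratio_prod_def using l by (simp add: prod_zero_iff) force
  have "isCont (f t) (a t l)"
    using f_continuous[of t] a_notin cofinite_open_connected(1)[of "B t"]
    by (simp add: continuous_on_eq_continuous_at)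
  then have "\<forall>\<^sub>F z in nhds (a t l). dist (f t z) (f t (a t l)) < e / (2 * c)"
    unfolding isCont_def tendsto_at_iff_tendsto_nhds using e c by (intro tendstoD) auto
  then obtain d' where d': "d' > 0" "\<And>z. dist z (a t l) < d' \<Longrightarrow> norm (f t z) < e / (2 * c)"
    unfolding eventually_nhds_metric f0 by auto
  \<comment> \<open>On this disc \<open>f t\<close> is below half the target size \<open>e / c\<close>, and uniform convergence provides the other half for \<open>f s\<close>.\<close>
  define r where "r = min d (d' / 2)"
  have r: "r > 0" using d d' by (simp add: r_def)
  have rB: "cball (a t l) r \<inter> B t = {}" using d(2) by (auto simp: r_def)
  have "((\<lambda>s. a s l) \<longlongrightarrow> a t l) F"
    using has_vector_derivative_continuous[OF a_deriv[OF l]] by (simp add: continuous_within)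
  from tendstoD[OF this r] have e1: "\<forall>\<^sub>F s in F. dist (a s l) (a t l) < r" .
  have "((\<lambda>s. norm ((a s l - a t l) / of_real (s - t))) \<longlongrightarrow> norm (a' l)) F"
    using a_deriv[OF l] unfolding has_vector_derivative_quotient by (rule tendsto_norm)
  then have e2: "\<forall>\<^sub>F s in F. norm ((a s l - a t l) / of_real (s - t)) < c"
    by (rule order_tendstoD) (simp add: c_def)
  have "e / (2 * c) > 0" using e c by simp
  from uniform_limitD[OF has_uniform_derivative_uniform_limit[OF f_uniform_derivative[OF compact_cball rB]] this]
  have e3: "\<forall>\<^sub>F s in F. \<forall>z\<in>cball (a t l) r. dist (f s z) (f t z) < e / (2 * c)" .
  show "\<forall>\<^sub>F s in F. dist ((R s (a s l) - R s (a t l)) / of_real (s - t)) 0 < e"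
    using e1 e2 e3 eventually_in_T eventually_avoids_poles[OF closed_cball rB]
  proof eventually_elim
    fix s assume s: "dist (a s l) (a t l) < r" "norm ((a s l - a t l) / of_real (s - t)) < c"
      "\<forall>z\<in>cball (a t l) r. dist (f s z) (f t z) < e / (2 * c)" "s \<in> T \<and> s \<noteq> t" "cball (a t l) r \<inter> B s = {}"
    have "norm (R s (a s l) - R s (a t l)) \<le> (e / c) * norm (a s l - a t l)"
    proof (rule field_differentiable_bound[where S="cball (a t l) r" and f="R s" and f'="f s"])
      fix z assume z: "z \<in> cball (a t l) r"
      then show "(R s has_field_derivative f s z) (at z within cball (a t l) r)"
        using s by (intro has_field_derivative_at_within[OF R_deriv]) auto
      have "dist z (a t l) < d'" using z d'(1) r by (auto simp: r_def dist_commute min_def split: if_splits)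
      then have "norm (f t z) < e / (2 * c)" by (rule d'(2))
      moreover have "norm (f s z - f t z) < e / (2 * c)"
        using s(3) z by (simp add: dist_norm[symmetric] del: mem_cball)
      moreover have "e / (2 * c) + e / (2 * c) = e / c" using c by simp
      ultimately show "norm (f s z) \<le> e / c"
        using norm_triangle_sub[of "f s z" "f t z"] by linarith
    qed (use s(1) r in \<open>auto simp: dist_commute\<close>)
    then have "norm ((R s (a s l) - R s (a t l)) / of_real (s - t))
        \<le> ((e / c) * norm (a s l - a t l)) / norm (of_real (s - t) :: complex)"
      unfolding norm_divide by (intro divide_right_mono) auto
    also have "\<dots> = (e / c) * norm ((a s l - a t l) / of_real (s - t))"
      by (simp only: norm_divide times_divide_eq_right)
    also have "\<dots> < (e / c) * c"
      using s(2) e c by (intro mult_strict_left_mono) auto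
    finally show "dist ((R s (a s l) - R s (a t l)) / of_real (s - t)) 0 < e"
      using c by (simp add: dist_norm)
  qed
qed

definition G :: "complex \<Rightarrow> complex" where "G z = Lim F (\<lambda>s. Q s z)"

lemma radii_exist:
  obtains r \<rho> :: real where "0 < r" "r < \<rho>" "\<And>z. z \<in> B t \<Longrightarrow> norm z < r"
proof -
  have "bounded (B t)" by (intro finite_imp_bounded) simp
  then obtain r where "r > 0" "\<And>z. z \<in> B t \<Longrightarrow> norm z < r"
    unfolding bounded_pos_less by blast
  then show ?thesis by (intro that[of r "r + 1"]) auto
qed

lemma Q_circle_mean:
  assumes le: "total_crit M m \<le> total_pole N n"
    and r: "0 < r" "r < \<rho>" "\<And>z. z \<in> B t \<Longrightarrow> norm z < r"
  shows "\<forall>\<^sub>F s in F. ((\<lambda>w. Q s (inverse w) / w) has_contour_integral 0) (circlepath 0 (1 / \<rho>))"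
proof -
  have mean: "((\<lambda>w. R s (inverse w) / w) has_contour_integral 0) (circlepath 0 (1 / \<rho>))"
    if "s \<in> T" "\<And>z. z \<in> B s \<Longrightarrow> norm z \<le> r" for s
    by (rule critical_data.normalized_circle_mean[OF data R_deriv normalized le r(1,2) that(2)]) (use that in auto)
  have "closed (- ball 0 r)" "- ball 0 r \<inter> B t = {}"
    using r(3) by (auto simp: closed_Compl)
  from eventually_avoids_poles[OF this] eventually_in_T show ?thesis
  proof eventually_elim
    fix s assume s: "- ball 0 r \<inter> B s = {}" "s \<in> T \<and> s \<noteq> t"
    have "((\<lambda>w. R s (inverse w) / w) has_contour_integral 0) (circlepath 0 (1 / \<rho>))"
    proof (rule mean)
      show "norm z \<le> r" if "z \<in> B s" for z
        using that s(1) by (metis ComplI disjoint_iff linorder_not_less mem_ball_0 order_less_imp_le)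
    qed (use s in simp)
    moreover have "((\<lambda>w. R t (inverse w) / w) has_contour_integral 0) (circlepath 0 (1 / \<rho>))"
      by (intro mean t less_imp_le r(3))
    ultimately have "((\<lambda>w. (R s (inverse w) / w - R t (inverse w) / w) / of_real (s - t))
        has_contour_integral (0 - 0) / of_real (s - t)) (circlepath 0 (1 / \<rho>))"
      by (intro has_contour_integral_div has_contour_integral_diff)
    then show "((\<lambda>w. Q s (inverse w) / w) has_contour_integral 0) (circlepath 0 (1 / \<rho>))"
      by (simp add: Q_def diff_divide_distrib divide_divide_eq_left mult.commute del: of_real_diff)
  qed
qed

text \<open>For \<open>m > n\<close> the base point is \<open>a t 1\<close>. Otherwise any point
\<open>y\<close> will do: the mean of \<open>Q s - Q s y\<close> over a large circle converges, and
it equals \<open>- Q s y\<close> since \<open>Q s\<close> has mean 0.\<close>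
lemma base_point:
  obtains z l where "z \<notin> B t" "((\<lambda>s. Q s z) \<longlongrightarrow> l) F"
proof (cases "total_crit M m \<le> total_pole N n")
  case False
  then have gt: "total_crit M m > total_pole N n" by simp
  note first = critical_data.normalized_first_critical_value[OF data normalized gt]
  have 1: "1 \<in> {1..M}" using first(1)[OF t t] .
  have notin: "a t 1 \<notin> B t" using critical_data.disj[OF data[OF t]] 1 by blast
  have "((\<lambda>s. - ((R s (a s 1) - R s (a t 1)) / of_real (s - t))) \<longlongrightarrow> - 0) F"
    by (intro tendsto_minus critical_value_shift 1)
  then have "((\<lambda>s. Q s (a t 1)) \<longlongrightarrow> - 0) F"
  proof (rule Lim_transform_eventually)
    show "\<forall>\<^sub>F s in F. - ((R s (a s 1) - R s (a t 1)) / of_real (s - t)) = Q s (a t 1)"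
      using eventually_in_T
    proof eventually_elim
      fix s assume s: "s \<in> T \<and> s \<noteq> t"
      then have "R s (a s 1) = 0" "R t (a t 1) = 0" using first(2) t by auto
      then show "- ((R s (a s 1) - R s (a t 1)) / of_real (s - t)) = Q s (a t 1)"
        by (simp add: Q_def del: of_real_diff)
    qed
  qed
  with notin show ?thesis by (rule that)
next
  case True
  obtain r \<rho> where r: "0 < r" "r < \<rho>" "\<And>z. z \<in> B t \<Longrightarrow> norm z < r"
    using radii_exist by blast
  obtain y where y: "y \<notin> B t"
    using ex_new_if_finite[OF infinite_UNIV_char_0, of "B t"] by auto
  define P where "P z = Lim F (\<lambda>s. Q s z - Q s y)" for z
  have P: "((\<lambda>s. Q s z - Q s y) \<longlongrightarrow> P z) F" if z: "z \<notin> B t" for z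
  proof -
    obtain l where l: "((\<lambda>s. Q s z - Q s y) \<longlongrightarrow> l) F"
      using increments_converge[OF y z] by blast
    then show ?thesis unfolding P_def using tendsto_Lim[OF nontrivial l] by simp
  qed
  have \<rho>: "0 < \<rho>" "sphere 0 \<rho> \<inter> B t = {}" using r by force+
  have mean: "\<forall>\<^sub>F s in F. ((\<lambda>w. Q s (inverse w) / w) has_contour_integral 0) (circlepath 0 (1 / \<rho>))"
    by (rule Q_circle_mean[OF True r])
  define C where "C = circlepath 0 (1 / \<rho>)"
  have unit: "((\<lambda>w. 1 / w) has_contour_integral 2 * of_real pi * \<i>) C"
    using Cauchy_integral_circlepath_simple[of "\<lambda>w. 1" 0 "1 / \<rho>" 0] \<rho> by (simp add: C_def)
  have "((\<lambda>s. contour_integral C (\<lambda>w. (Q s (inverse w) - Q s y) / w))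
      \<longlongrightarrow> contour_integral C (\<lambda>w. P (inverse w) / w)) F"
    unfolding C_def by (rule circle_mean_limit(2)[OF P \<rho>])
  then have lim: "((\<lambda>s. - (Q s y * (2 * of_real pi * \<i>))) \<longlongrightarrow> contour_integral C (\<lambda>w. P (inverse w) / w)) F"
  proof (rule Lim_transform_eventually)
    show "\<forall>\<^sub>F s in F. contour_integral C (\<lambda>w. (Q s (inverse w) - Q s y) / w) = - (Q s y * (2 * of_real pi * \<i>))"
      using mean
    proof eventually_elim
      fix s assume "((\<lambda>w. Q s (inverse w) / w) has_contour_integral 0) (circlepath 0 (1 / \<rho>))"
      from has_contour_integral_diff[OF this[folded C_def] has_contour_integral_lmul[OF unit, of "Q s y"]]
      have "((\<lambda>w. (Q s (inverse w) - Q s y) / w) has_contour_integral (- (Q s y * (2 * of_real pi * \<i>)))) C"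
        by (simp add: diff_divide_distrib)
      then show "contour_integral C (\<lambda>w. (Q s (inverse w) - Q s y) / w) = - (Q s y * (2 * of_real pi * \<i>))"
        by (rule contour_integral_unique)
    qed
  qed
  have two_pi_i: "(2 * of_real pi * \<i>) * inverse (2 * of_real pi * \<i>) = 1"
    by (rule right_inverse) simp
  from tendsto_mult_right[OF lim, of "- inverse (2 * of_real pi * \<i>)"]
  have "((\<lambda>s. Q s y) \<longlongrightarrow> contour_integral C (\<lambda>w. P (inverse w) / w) * - inverse (2 * of_real pi * \<i>)) F"
    by (simp only: minus_mult_minus mult.assoc[of "Q _ y"] two_pi_i mult_1_right)
  with y show ?thesis by (rule that)
qed

lemma Q_tendsto:
  assumes z: "z \<notin> B t"
  shows "((\<lambda>s. Q s z) \<longlongrightarrow> G z) F"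
proof -
  obtain y l where y: "y \<notin> B t" "((\<lambda>s. Q s y) \<longlongrightarrow> l) F" by (rule base_point)
  obtain k where "((\<lambda>s. Q s z - Q s y) \<longlongrightarrow> k) F"
    using increments_converge[OF y(1) z] by blast
  from tendsto_add[OF this y(2)] have "((\<lambda>s. Q s z) \<longlongrightarrow> k + l) F" by simp
  from this tendsto_Lim[OF nontrivial this] show ?thesis by (simp add: G_def)
qed

lemma R_has_vector_derivative:
  assumes "z \<notin> B t"
  shows "((\<lambda>s. R s z) has_vector_derivative G z) F"
  unfolding has_vector_derivative_quotient using Q_tendsto[OF assms] by (simp only: Q_def)

lemma critical_value_has_vector_derivative:
  assumes l: "l \<in> {1..M}"
  shows "((\<lambda>s. R s (a s l)) has_vector_derivative G (a t l)) F"
proof -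
  have "a t l \<notin> B t" using critical_data.disj[OF data[OF t]] l by blast
  from tendsto_add[OF critical_value_shift[OF l] Q_tendsto[OF this]]
  show ?thesis
    unfolding has_vector_derivative_quotient Q_def add_divide_distrib[symmetric] by simp
qed

lemma G_circle_mean:
  assumes le: "total_crit M m \<le> total_pole N n"
    and r: "0 < r" "r < \<rho>" "\<And>z. z \<in> B t \<Longrightarrow> norm z < r"
  shows "((\<lambda>w. G (inverse w) / w) has_contour_integral 0) (circlepath 0 (1 / \<rho>))"
proof -
  have \<rho>: "0 < \<rho>" "sphere 0 \<rho> \<inter> B t = {}" using r by force+
  have G0: "((\<lambda>s. Q s z - 0) \<longlongrightarrow> G z) F" if "z \<notin> B t" for z
    using Q_tendsto[OF that] by simp
  have mean: "\<forall>\<^sub>F s in F. ((\<lambda>w. Q s (inverse w) / w) has_contour_integral 0) (circlepath 0 (1 / \<rho>))"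
    by (rule Q_circle_mean[OF le r])
  have int: "(\<lambda>w. G (inverse w) / w) contour_integrable_on circlepath 0 (1 / \<rho>)"
    and lim: "((\<lambda>s. contour_integral (circlepath 0 (1 / \<rho>)) (\<lambda>w. (Q s (inverse w) - 0) / w))
      \<longlongrightarrow> contour_integral (circlepath 0 (1 / \<rho>)) (\<lambda>w. G (inverse w) / w)) F"
    by (rule circle_mean_limit[OF G0 \<rho>]; assumption)+
  have "((\<lambda>s. 0) \<longlongrightarrow> contour_integral (circlepath 0 (1 / \<rho>)) (\<lambda>w. G (inverse w) / w)) F"
  proof (rule Lim_transform_eventually[OF lim])
    show "\<forall>\<^sub>F s in F. contour_integral (circlepath 0 (1 / \<rho>)) (\<lambda>w. (Q s (inverse w) - 0) / w) = 0"
      using mean by eventually_elim (simp add: contour_integral_unique)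
  qed
  from tendsto_unique[OF nontrivial this tendsto_const]
  have "contour_integral (circlepath 0 (1 / \<rho>)) (\<lambda>w. G (inverse w) / w) = 0" by simp
  then show ?thesis
    using has_contour_integral_integral[OF int] by simp
qed

theorem family_differential_equation:
  assumes z: "z \<notin> a t ` {1..M}" "z \<notin> B t"
  shows "G z / f t z = (\<Sum>l=1..M. taylor_poly (H_fun M N m n (a t) (b t) l) (a t l) (m l - 2) z
      / (z - a t l) ^ (m l - 1) * G (a t l))"
proof -
  obtain r \<rho> where r: "0 < r" "r < \<rho>" "\<And>z. z \<in> B t \<Longrightarrow> norm z < r"
    using radii_exist by blast
  have "critical_variation M N m n (a t) (b t) a' b' G f_dot r \<rho>"
  proof (intro critical_variation.intro critical_variation_axioms.intro data t)
    show "(G has_field_derivative f_dot z) (at z)" if "z \<notin> B t" for z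
      using limit_deriv[of "\<lambda>s. 0" G, OF _ that] Q_tendsto by simp
    show "f_dot z = f t z * ((\<Sum>j=1..N. of_nat (n j + 1) * b' j / (z - b t j))
      - (\<Sum>l=1..M. of_nat (m l - 1) * a' l / (z - a t l)))" if "z \<notin> a t ` {1..M}" "z \<notin> B t" for z
      using that by (rule f_dot_eq)
    show "(\<Sum>l=1..M. of_nat (m l - 1) * a' l) = (\<Sum>j=1..N. of_nat (n j + 1) * b' j)"
      by (rule centered_deriv)
    show "norm z \<le> r" if "z \<in> B t" for z using r(3)[OF that] by simp
    show "((\<lambda>w. G (inverse w) / w) has_contour_integral 0) (circlepath 0 (1 / \<rho>))"
      if "total_crit M m \<le> total_pole N n"
      using that r by (rule G_circle_mean)
  qed (use r in auto)
  from critical_variation.quotient_eq_principal_parts[OF this z] show ?thesis .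
qed

end

section \<open>The differential equation\<close>

lemma smooth_fun_on_has_vector_derivative:
  assumes "smooth_fun_on T f" "t \<in> T"
  shows "(f has_vector_derivative vector_derivative f (at t within T)) (at t within T)"
proof -
  obtain D where D: "\<forall>s\<in>T. D 0 s = f s"
    "\<forall>k. \<forall>s\<in>T. (D k has_vector_derivative D (Suc k) s) (at s within T)"
    using assms(1) unfolding smooth_fun_on_def by blast
  have "(f has_vector_derivative D (Suc 0) t) (at t within T)"
    using has_vector_derivative_transform[of t T f "D 0"] D assms(2) by auto
  then have "f differentiable (at t within T)" by (rule differentiableI_vector)
  then show ?thesis by (simp only: vector_derivative_works)
qed

theorem mainTheorem1:
  fixes T :: "real set"
    and M N :: nat
    and m n :: "nat \<Rightarrow> nat"
    and a b :: "real \<Rightarrow> nat \<Rightarrow> complex"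
    and R :: "real \<Rightarrow> complex \<Rightarrow> complex"
  assumes interval: "is_interval T" "\<exists>s\<in>T. \<exists>t\<in>T. s < t"
    and m_ge: "\<And>l. l \<in> {1..M} \<Longrightarrow> m l \<ge> 2"
    and n_ge: "\<And>j. j \<in> {1..N} \<Longrightarrow> n j \<ge> 1"
    and smooth_a: "\<And>l. l \<in> {1..M} \<Longrightarrow> smooth_fun_on T (\<lambda>t. a t l)"
    and smooth_b: "\<And>j. j \<in> {1..N} \<Longrightarrow> smooth_fun_on T (\<lambda>t. b t j)"
    and distinct_a: "\<And>t. t \<in> T \<Longrightarrow> inj_on (a t) {1..M}"
    and distinct_b: "\<And>t. t \<in> T \<Longrightarrow> inj_on (b t) {1..N}"
    and distinct_ab: "\<And>t. t \<in> T \<Longrightarrow> a t ` {1..M} \<inter> b t ` {1..N} = {}"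
    and rational: "\<And>t. t \<in> T \<Longrightarrow> rational_with_data M N m n (a t) (b t) (R t)"
    and additive_const: "\<And>t. t \<in> T \<Longrightarrow> additive_normalized M N m n (a t) (b t) (R t)"
    and centered: "\<And>t. t \<in> T \<Longrightarrow>
      (\<Sum>k=1..M. of_nat (m k - 1) * a t k) - (\<Sum>j=1..N. of_nat (n j + 1) * b t j) = 0"
  shows "\<forall>t\<in>T.
    (\<forall>l\<in>{1..M}. (\<lambda>s. R s (a s l)) differentiable (at t within T)) \<and>
    (\<forall>z. z \<notin> a t ` {1..M} \<union> b t ` {1..N} \<longrightarrow>
      (\<lambda>s. R s z) differentiable (at t within T) \<and>
      vector_derivative (\<lambda>s. R s z) (at t within T) / deriv (R t) z =
        (\<Sum>l=1..M. taylor_poly (H_fun M N m n (a t) (b t) l) (a t l) (m l - 2) z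
                     / (z - a t l) ^ (m l - 1)
                     * vector_derivative (\<lambda>s. R s (a s l)) (at t within T)))"
proof
  fix t assume t: "t \<in> T"
  define F where "F = at t within T"
  define a' where "a' l = vector_derivative (\<lambda>s. a s l) F" for l
  define b' where "b' j = vector_derivative (\<lambda>s. b s j) F" for j
  have "connected T" using interval(1) is_interval_connected by blast
  moreover have "T \<noteq> {x}" for x using interval(2) by auto
  ultimately have "t islimpt T" using t by (intro connected_imp_perfect)
  then have nontrivial: "F \<noteq> bot" by (simp add: F_def trivial_limit_within)
  have a': "((\<lambda>s. a s l) has_vector_derivative a' l) F" if "l \<in> {1..M}" for l
    unfolding a'_def F_def by (intro smooth_fun_on_has_vector_derivative smooth_a that t)
  have b': "((\<lambda>s. b s j) has_vector_derivative b' j) F" if "j \<in> {1..N}" for j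
    unfolding b'_def F_def by (intro smooth_fun_on_has_vector_derivative smooth_b that t)
  have R': "(R s has_field_derivative ratio_prod M N m n (a s) (b s) z) (at z)"
    if "s \<in> T" "z \<notin> b s ` {1..N}" for s z
    using rational[OF that(1)] that(2) unfolding rational_with_data_def by blast
  \<comment> \<open>The centering condition holds on all of \<open>T\<close>, so it may be differentiated.\<close>
  define S where "S = (\<lambda>s. (\<Sum>k=1..M. of_nat (m k - 1) * a s k) - (\<Sum>j=1..N. of_nat (n j + 1) * b s j))"
  have "(S has_vector_derivative
      (\<Sum>k=1..M. of_nat (m k - 1) * a' k) - (\<Sum>j=1..N. of_nat (n j + 1) * b' j)) F"
    unfolding S_def
    by (intro has_vector_derivative_diff has_vector_derivative_sum has_vector_derivative_mult_right a' b')
  moreover have "(S has_vector_derivative 0) F"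
    unfolding F_def
    by (rule has_vector_derivative_transform[OF t _ has_vector_derivative_const[of 0]])
       (simp only: S_def centered)
  ultimately have "(\<Sum>k=1..M. of_nat (m k - 1) * a' k) - (\<Sum>j=1..N. of_nat (n j + 1) * b' j) = 0"
    using nontrivial unfolding F_def by (intro vector_derivative_unique_within)
  then have sums: "(\<Sum>k=1..M. of_nat (m k - 1) * a' k) = (\<Sum>j=1..N. of_nat (n j + 1) * b' j)"
    by simp
  have "critical_family T t M N m n a b a' b' R"
  proof (rule critical_family.intro)
    show "t \<in> T" by (rule t)
    show "at t within T \<noteq> bot" using nontrivial unfolding F_def .
    show "critical_data M N m (a s) (b s)" if "s \<in> T" for s
      by (intro critical_data.intro m_ge distinct_a distinct_b distinct_ab that)
  qed (intro a'[unfolded F_def] b'[unfolded F_def] R' additive_const sums; assumption)+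
  then interpret fam: critical_family T t M N m n a b a' b' R .
  have crit: "((\<lambda>s. R s (a s l)) has_vector_derivative fam.G (a t l)) (at t within T)" if "l \<in> {1..M}" for l
    by (rule fam.critical_value_has_vector_derivative[OF that])
  have eq: "vector_derivative (\<lambda>s. R s z) (at t within T) / deriv (R t) z =
        (\<Sum>l=1..M. taylor_poly (H_fun M N m n (a t) (b t) l) (a t l) (m l - 2) z
                     / (z - a t l) ^ (m l - 1)
                     * vector_derivative (\<lambda>s. R s (a s l)) (at t within T))"
    if z: "z \<notin> a t ` {1..M}" "z \<notin> b t ` {1..N}" for z
  proof -
    have "vector_derivative (\<lambda>s. R s z) (at t within T) = fam.G z"
      by (rule vector_derivative_within[OF fam.nontrivial fam.R_has_vector_derivative[OF z(2)]])
    moreover have "deriv (R t) z = ratio_prod M N m n (a t) (b t) z"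
      by (rule DERIV_imp_deriv[OF R'[OF t z(2)]])
    moreover have "vector_derivative (\<lambda>s. R s (a s l)) (at t within T) = fam.G (a t l)" if "l \<in> {1..M}" for l
      by (rule vector_derivative_within[OF fam.nontrivial crit[OF that]])
    ultimately show ?thesis
      using fam.family_differential_equation[OF z] by simp
  qed
  show "(\<forall>l\<in>{1..M}. (\<lambda>s. R s (a s l)) differentiable (at t within T)) \<and>
    (\<forall>z. z \<notin> a t ` {1..M} \<union> b t ` {1..N} \<longrightarrow>
      (\<lambda>s. R s z) differentiable (at t within T) \<and>
      vector_derivative (\<lambda>s. R s z) (at t within T) / deriv (R t) z =
        (\<Sum>l=1..M. taylor_poly (H_fun M N m n (a t) (b t) l) (a t l) (m l - 2) z
                     / (z - a t l) ^ (m l - 1)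
                     * vector_derivative (\<lambda>s. R s (a s l)) (at t within T)))"
    using differentiableI_vector[OF crit] differentiableI_vector[OF fam.R_has_vector_derivative] eq
    by blast
qed

end
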